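(* For $c=a+ib\in\mathbb{C}$ let $g_c\colon\mathbb{R}^2\to\mathbb{R}^2$, $g_c(x,y)=(x^2-y^2+a,\,2xy+b)$, and consider the Point Escape Problem instance $(g_c,\overline{B}(0,3),0)$ in $\mathbb{R}^2$. Then $c\in\mathcal{M}$ if and only if $0$ is trapped in $\overline{B}(0,3)$ under $g_c$ (so $c\mapsto(g_c,\overline{B}(0,3),0)$ is a reduction of membership in $\mathcal{M}$ to the Point Escape Problem). Moreover, $(g_c,\overline{B}(0,3),0)$ is a robust instance of the Point Escape Problem if and only if $c\in\mathbb{C}\setminus\mathcal{M}$ or $c$ belongs to a hyperbolic component of $\operatorname{int}\mathcal{M}$. In particular, this reduction maps every parameter $c\notin\partial\mathcal{M}$ to a robust instance if and only if the hyperbolicity conjecture holds.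
   Context: $\mathbb{R}^2$ is identified with $\mathbb{C}$, balls use the supremum norm, so $\overline{B}(0,3)=\{z:\|z\|_\infty\le3\}$. For $c\in\mathbb{C}$ let $f_c(z)=z^2+c$; the Mandelbrot set $\mathcal{M}$ is the set of $c$ such that the orbit of $0$ under $f_c$ is bounded. A parameter $c\in\operatorname{int}\mathcal{M}$ is hyperbolic if $f_c$ has an attracting cycle: there are $z_0\in\mathbb{C}$ and $n\ge1$ with $f_c^n(z_0)=z_0$, the points $f_c^j(z_0)$, $j<n$, pairwise distinct, and $|(f_c^n)'(z_0)|<1$. A connected component of $\operatorname{int}\mathcal{M}$ is called hyperbolic if its parameters are hyperbolic. The hyperbolicity conjecture states that every point of $\operatorname{int}\mathcal{M}$ is hyperbolic. Point Escape Problem (in $\mathbb{R}^d$, here $d=2$): an instance is $(f,A,x_0)$ with $f\colon\mathbb{R}^d\to\mathbb{R}^d$ continuous, $A\subseteq\mathbb{R}^d$ closed, $x_0\in A$; $x_0$ escapes $A$ under $f$ if $f^k(x_0)\notin A$ for some $k\in\mathbb{N}$, and is trapped otherwise. An instance is robust if it has a neighbourhood on which the answer is constant, where the space of instances carries the product of: the Euclidean topology on points; the compact-open topology on continuous maps; and the topology on closed sets in which a basic neighbourhood of $A$ is the set of closed sets having a name beginning with a given finite initial segment of a name of $A$. Here, with $\mathscr{Q}^d_n$ the set of dyadic cubes $\prod_i[x_i2^{-n},(x_i+1)2^{-n}]$ ($x_i\in\mathbb{Z}$), $|S|$ the union of a set $S$ of cubes, and $B\Subset C$ meaning $\overline{B}\subseteq\operatorname{int}C$,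 a name of a closed set $A$ is a sequence $(I_n,E_n)_n$ of pairs of finite subsets of $\mathscr{Q}^d_n$ with $|I_n|\Subset A$, $\operatorname{int}A=\bigcup_n\operatorname{int}|I_n|$, $|E_n|\Subset\mathbb{R}^d\setminus A$, $\mathbb{R}^d\setminus A=\bigcup_n\operatorname{int}|E_n|$, and such that subcubes in $\mathscr{Q}^d_{n+1}$ of cubes in $I_n$ (resp. $E_n$) lie in $I_{n+1}$ (resp. $E_{n+1}$). *)

theory Defs
  imports "HOL-Analysis.Analysis"
begin

definition quad :: "complex \<Rightarrow> complex \<Rightarrow> complex" where
  "quad c z = z\<^sup>2 + c"

definition mandelbrot :: "complex set" where
  "mandelbrot = {c. bounded (range (\<lambda>n. (quad c ^^ n) 0))}"

definition has_attracting_cycle :: "(complex \<Rightarrow> complex) \<Rightarrow> bool" where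
  "has_attracting_cycle f \<longleftrightarrow>
     (\<exists>z\<^sub>0 n. n \<ge> 1 \<and> (f ^^ n) z\<^sub>0 = z\<^sub>0 \<and> inj_on (\<lambda>j. (f ^^ j) z\<^sub>0) {..<n} \<and>
            norm (deriv (f ^^ n) z\<^sub>0) < 1)"

definition hyperbolic_parameter :: "complex \<Rightarrow> bool" where
  "hyperbolic_parameter c \<longleftrightarrow> c \<in> interior mandelbrot \<and> has_attracting_cycle (quad c)"

definition hyperbolic_component :: "complex set \<Rightarrow> bool" where
  "hyperbolic_component H \<longleftrightarrow>
     H \<in> components (interior mandelbrot) \<and> (\<forall>c\<in>H. hyperbolic_parameter c)"

definition hyperbolicity_conjecture :: bool where
  "hyperbolicity_conjecture \<longleftrightarrow> (\<forall>c\<in>interior mandelbrot. hyperbolic_parameter c)"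

definition dyadic_cubes :: "nat \<Rightarrow> 'a::euclidean_space set set" where
  "dyadic_cubes n =
     {{p. \<forall>i\<in>Basis. of_int (x i) / 2 ^ n \<le> p \<bullet> i \<and> p \<bullet> i \<le> (of_int (x i) + 1) / 2 ^ n}
       | x :: 'a \<Rightarrow> int. True}"

definition well_inside :: "'a::topological_space set \<Rightarrow> 'a set \<Rightarrow> bool"  (infix "\<Subset>" 50) where
  "B \<Subset> C \<longleftrightarrow> closure B \<subseteq> interior C"

text \<open>A sequence of pairs \<open>(I\<^sub>n, E\<^sub>n)\<close> is represented by the two sequences \<open>I\<close> and \<open>E\<close>.\<close>

definition is_name ::
    "(nat \<Rightarrow> 'a::euclidean_space set set) \<Rightarrow> (nat \<Rightarrow> 'a set set) \<Rightarrow> 'a set \<Rightarrow> bool" where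
  "is_name I E A \<longleftrightarrow>
     (\<forall>n. finite (I n) \<and> I n \<subseteq> dyadic_cubes n \<and> finite (E n) \<and> E n \<subseteq> dyadic_cubes n) \<and>
     (\<forall>n. \<Union>(I n) \<Subset> A) \<and> interior A = (\<Union>n. interior (\<Union>(I n))) \<and>
     (\<forall>n. \<Union>(E n) \<Subset> - A) \<and> - A = (\<Union>n. interior (\<Union>(E n))) \<and>
     (\<forall>n. \<forall>Q\<in>I n. \<forall>Q'\<in>dyadic_cubes (Suc n). Q' \<subseteq> Q \<longrightarrow> Q' \<in> I (Suc n)) \<and>
     (\<forall>n. \<forall>Q\<in>E n. \<forall>Q'\<in>dyadic_cubes (Suc n). Q' \<subseteq> Q \<longrightarrow> Q' \<in> E (Suc n))"

text \<open>The closed sets having a name that agrees with \<open>(I, E)\<close> in its first \<open>m\<close> entries.\<close>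

definition prefix_nbhd ::
    "(nat \<Rightarrow> 'a::euclidean_space set set) \<Rightarrow> (nat \<Rightarrow> 'a set set) \<Rightarrow> nat \<Rightarrow> 'a set set" where
  "prefix_nbhd I E m =
     {B. closed B \<and> (\<exists>I' E'. is_name I' E' B \<and> (\<forall>k<m. I' k = I k \<and> E' k = E k))}"

text \<open>
  The generating sets are a base: if \<open>B\<close> lies in two of them, the entrywise union of two
  corresponding names of \<open>B\<close> is again a name of \<open>B\<close>, and a sufficiently long prefix of it
  determines a generating set contained in both.
\<close>

definition closed_sets_topology :: "'a::euclidean_space set topology" where
  "closed_sets_topology =
     topology_generated_by {prefix_nbhd I E m | I E m. \<exists>A. closed A \<and> is_name I E A}"

definition compact_open_topology ::
    "('a::topological_space \<Rightarrow> 'b::topological_space) topology" where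
  "compact_open_topology =
     topology_generated_by
       {{f. continuous_on UNIV f \<and> f ` K \<subseteq> U} | K U. compact K \<and> open U}"

type_synonym 'a pep_instance = "('a \<Rightarrow> 'a) \<times> 'a set \<times> 'a"

definition pep_instances :: "'a::euclidean_space pep_instance set" where
  "pep_instances = {(f, A, x\<^sub>0). continuous_on UNIV f \<and> closed A \<and> x\<^sub>0 \<in> A}"

definition pep_topology :: "'a::euclidean_space pep_instance topology" where
  "pep_topology =
     subtopology
       (prod_topology compact_open_topology (prod_topology closed_sets_topology euclidean))
       pep_instances"

definition escapes :: "'a pep_instance \<Rightarrow> bool" where
  "escapes = (\<lambda>(f, A, x\<^sub>0). \<exists>k. (f ^^ k) x\<^sub>0 \<notin> A)"

definition trapped :: "'a pep_instance \<Rightarrow> bool" where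
  "trapped P \<longleftrightarrow> \<not> escapes P"

definition robust :: "'a::euclidean_space pep_instance \<Rightarrow> bool" where
  "robust P \<longleftrightarrow>
     (\<exists>V. openin pep_topology V \<and> P \<in> V \<and> (\<forall>Q\<in>V. escapes Q \<longleftrightarrow> escapes P))"

definition real_quad :: "complex \<Rightarrow> real \<times> real \<Rightarrow> real \<times> real" where
  "real_quad c = (\<lambda>(x, y). (x\<^sup>2 - y\<^sup>2 + Re c, 2 * x * y + Im c))"

text \<open>\<open>infnorm\<close> is the supremum norm; \<open>cball\<close> on pairs would be the Euclidean ball.\<close>

definition mandelbrot_instance :: "complex \<Rightarrow> (real \<times> real) pep_instance" where
  "mandelbrot_instance c = (real_quad c, {z. infnorm z \<le> 3}, 0)"

end

theory Submission
  imports Defs "HOL-Complex_Analysis.Complex_Analysis"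
begin

text \<open>
  Escaping is an open condition, so only trapped parameters \<open>c \<in> mandelbrot\<close> matter.
  If the instance of \<open>c\<close> is robust, then for some \<open>\<epsilon>\<close> all points reached from \<open>0\<close> by maps uniformly
  \<open>\<epsilon>\<close>-close to \<open>quad c\<close> form a bounded set containing the \<open>\<epsilon>\<close>-neighbourhood of its own image. By
  compactness an iterate of \<open>quad c\<close> maps some component of an open subset strictly inside itself, and
  the Earle--Hamilton theorem gives an attracting cycle. Conversely, Fatou's theorem takes the critical
  orbit into a disc around a point of an attracting cycle; such a trapping disc survives
  perturbation of map, set and point.
  Finally hyperbolicity spreads over a component of the interior: by Montel's theorem the
  critical orbit, sampled along the period, converges on the whole component to a periodic point
  depending holomorphically on \<open>c\<close>. Its multiplier has modulus at most 1, because convergence to a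
  repelling point would make the critical point preperiodic for uncountably many parameters, and then
  less than 1 by the maximum modulus principle.
\<close>

subsection \<open>Strictly invariant domains\<close>

lemma continuous_on_funpow:
  fixes f :: "'a::topological_space \<Rightarrow> 'a"
  assumes "continuous_on UNIV f"
  shows "continuous_on S (f ^^ n)"
proof -
  have "continuous_on UNIV (f ^^ n)"
  proof (induction n)
    case (Suc n)
    then show ?case
      using continuous_on_compose2[OF assms Suc] by (simp add: o_def)
  qed (simp add: id_def)
  then show ?thesis
    using continuous_on_subset by blast
qed

lemma funpow_in_invariant:
  assumes "\<And>x. x \<in> S \<Longrightarrow> f x \<in> S" "x \<in> S"
  shows "(f ^^ k) x \<in> S"
  by (induction k) (use assms in auto)

lemma funpow_fixpoint:
  assumes "f x = x"
  shows "(f ^^ k) x = x"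
  by (induction k) (use assms in auto)

lemma holomorphic_on_funpow:
  assumes "f holomorphic_on S" "\<And>x. x \<in> S \<Longrightarrow> f x \<in> S"
  shows "(f ^^ n) holomorphic_on S"
proof (induction n)
  case (Suc n)
  have "(f ^^ n) ` S \<subseteq> S"
    using funpow_in_invariant[of S f] assms(2) by blast
  then show ?case
    using holomorphic_on_compose_gen[OF Suc assms(1)] by (simp add: o_def)
qed (simp add: id_def)

lemma deriv_bound_ball:
  assumes "f holomorphic_on S" "open S" "cball z r \<subseteq> S" "0 < r"
    and "\<And>w. w \<in> S \<Longrightarrow> norm (f w) \<le> B"
  shows "norm (deriv f z) \<le> B / r"
proof -
  have "norm ((deriv ^^ 1) f z) \<le> fact 1 * B / r ^ 1"
  proof (rule Cauchy_inequality)
    show "f holomorphic_on ball z r"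
      using assms(1,3) ball_subset_cball holomorphic_on_subset by (metis subset_trans)
    show "continuous_on (cball z r) f"
      using assms(1,3) holomorphic_on_imp_continuous_on continuous_on_subset by blast
    show "norm (f x) \<le> B" if "norm (z - x) = r" for x
      using assms(3) that by (intro assms(5)) (auto simp: dist_norm)
  qed fact
  then show ?thesis by simp
qed

lemma deriv_funpow_at_fixpoint:
  assumes "f holomorphic_on S" "open S" "z \<in> S" "f z = z"
  shows "((f ^^ n) has_field_derivative deriv f z ^ n) (at z)"
proof (induction n)
  case (Suc n)
  have "(f has_field_derivative deriv f z) (at ((f ^^ n) z))"
    using assms by (simp add: funpow_fixpoint holomorphic_derivI)
  from DERIV_chain[OF this Suc] show ?case by (simp add: o_def)
qed (simp add: id_def)

text \<open>The maps \<open>\<lambda>y. F y + \<delta> * (F y - F x)\<close> with \<open>x\<close> on the orbit still send \<open>W\<close> into itself, so the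
  Cauchy estimate for their compositions gains a factor \<open>1 + \<delta>\<close> in each step.\<close>

lemma funpow_deriv_bound:
  assumes W: "open W" "bounded W" and F: "F holomorphic_on W"
    and "0 < \<epsilon>" and margin: "\<And>z. z \<in> W \<Longrightarrow> ball (F z) \<epsilon> \<subseteq> W"
  obtains M q where "0 < M" "0 < q" "q < 1"
    "\<And>x r k. cball x r \<subseteq> W \<Longrightarrow> 0 < r \<Longrightarrow> norm (deriv (F ^^ k) x) \<le> M / r * q ^ k"
proof -
  obtain M where M: "0 < M" "\<And>z. z \<in> W \<Longrightarrow> norm z \<le> M"
    using \<open>bounded W\<close> bounded_pos by metis
  \<comment> \<open>Two points of \<open>W\<close> are at most \<open>2 * M\<close> apart, so the
    correction term has size at most \<open>\<epsilon> / 2\<close> and stays within the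
    margin.\<close>
  define \<delta> where "\<delta> = \<epsilon> / (4 * M)"
  have "\<delta> > 0" using \<open>0 < \<epsilon>\<close> \<open>0 < M\<close> by (simp add: \<delta>_def)
  have FW: "F z \<in> W" if "z \<in> W" for z
    using margin[OF that] \<open>0 < \<epsilon>\<close> by auto
  define q where "q = 1 / (1 + \<delta>)"
  have "norm (deriv (F ^^ k) x) \<le> M / r * q ^ k" if x: "cball x r \<subseteq> W" "0 < r" for x r k
  proof -
    define G where "G = (\<lambda>k y. (1 + \<delta>) * F y - \<delta> * F ((F ^^ k) x))"
    \<comment> \<open>\<open>H k\<close> composes \<open>G 0\<close>, ..., \<open>G (k - 1)\<close>.
      The map changes at each step because its correction must vanish at the current orbit point:
      the orbit of \<open>x\<close> is kept while each derivative along it gains the factor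
      \<open>1 + \<delta>\<close>.\<close>
    define H where "H = rec_nat (\<lambda>y. y) (\<lambda>k h y. G k (h y))"
    have H0: "H 0 = (\<lambda>y. y)" and HS: "\<And>k. H (Suc k) = (\<lambda>y. G k (H k y))"
      by (simp_all add: H_def)
    have "x \<in> W" using x by auto
    then have xk: "(F ^^ k) x \<in> W" for k
      using funpow_in_invariant[of W F] FW by blast
    have GW: "G k y \<in> W" if "y \<in> W" for k y
    proof -
      have "G k y - F y = of_real \<delta> * (F y - F ((F ^^ k) x))"
        by (simp add: G_def algebra_simps)
      then have "norm (G k y - F y) = \<delta> * norm (F y - F ((F ^^ k) x))"
        using \<open>\<delta> > 0\<close> by (simp add: norm_mult)
      also have "\<dots> \<le> \<delta> * (2 * M)"
        using norm_triangle_ineq4[of "F y" "F ((F ^^ k) x)"] M(2)[OF FW[OF that]]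
          M(2)[OF FW[OF xk[of k]]] \<open>\<delta> > 0\<close>
        by (intro mult_left_mono) linarith+
      also have "\<dots> < \<epsilon>" using \<open>0 < M\<close> \<open>0 < \<epsilon>\<close> by (simp add: \<delta>_def field_simps)
      finally show ?thesis
        using margin[OF that] by (auto simp: dist_norm norm_minus_commute)
    qed
    have holG: "G k holomorphic_on W" for k
      unfolding G_def by (intro holomorphic_intros F)
    have HW: "H k y \<in> W" if "y \<in> W" for k y
      by (induction k) (use that GW in \<open>auto simp: H0 HS\<close>)
    have holH: "H k holomorphic_on W" for k
    proof (induction k)
      case (Suc k)
      show ?case
        using holomorphic_on_compose_gen[OF Suc holG[of k]] HW by (simp add: HS o_def image_subset_iff)
    qed (simp add: H0)
    have Hx: "H k x = (F ^^ k) x" for k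
      by (induction k) (simp_all add: H0 HS G_def algebra_simps)
    have holFk: "(F ^^ k) holomorphic_on W" for k
      using F FW by (rule holomorphic_on_funpow)
    have dH: "(H k has_field_derivative (1 + \<delta>) ^ k * deriv (F ^^ k) x) (at x)" for k
    proof (induction k)
      case (Suc k)
      have dF: "(F has_field_derivative deriv F ((F ^^ k) x)) (at ((F ^^ k) x))"
        using F W(1) xk by (rule holomorphic_derivI)
      have "((F ^^ k) has_field_derivative deriv (F ^^ k) x) (at x)"
        using holFk W(1) \<open>x \<in> W\<close> by (rule holomorphic_derivI)
      from DERIV_chain[OF dF this]
      have d: "deriv (F \<circ> F ^^ k) x = deriv F ((F ^^ k) x) * deriv (F ^^ k) x"
        by (rule DERIV_imp_deriv)
      have "(G k has_field_derivative (1 + \<delta>) * deriv F ((F ^^ k) x)) (at (H k x))"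
        unfolding G_def Hx by (auto intro!: derivative_eq_intros dF)
      from DERIV_chain2[OF this Suc] show ?case
        by (simp add: HS d mult_ac del: o_apply)
    qed (auto simp: H0 id_def)
    have "norm (deriv (H k) x) \<le> M / r"
      using holH W(1) x M(2) HW by (intro deriv_bound_ball[of _ W]) auto
    moreover have "norm (1 + complex_of_real \<delta>) = 1 + \<delta>"
      using \<open>\<delta> > 0\<close> norm_of_real[of "1 + \<delta>", where 'a = complex] by simp
    ultimately have "(1 + \<delta>) ^ k * norm (deriv (F ^^ k) x) \<le> M / r"
      unfolding DERIV_imp_deriv[OF dH[of k]] by (simp add: norm_mult norm_power)
    then have "norm (deriv (F ^^ k) x) \<le> (M / r) / (1 + \<delta>) ^ k"
      using \<open>\<delta> > 0\<close> by (subst pos_le_divide_eq) (simp_all add: mult.commute)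
    then show ?thesis
      by (simp add: q_def power_one_over)
  qed
  then show ?thesis
    using that[of M q] \<open>\<delta> > 0\<close> \<open>0 < M\<close> by (simp add: q_def)
qed

text \<open>A form of the Earle--Hamilton theorem. Derivatives of iterates decay geometrically on
  small discs, connectedness spreads this to any two orbits, and comparing an orbit with its own
  shift makes it Cauchy.\<close>

lemma strictly_inside_imp_attracting_fixpoint:
  assumes W: "open W" "connected W" "bounded W" "W \<noteq> {}" and F: "F holomorphic_on W"
    and "0 < \<epsilon>" and margin: "\<And>z. z \<in> W \<Longrightarrow> ball (F z) \<epsilon> \<subseteq> W"
  obtains p where "p \<in> W" "F p = p" "norm (deriv F p) < 1"
    "\<And>x. x \<in> W \<Longrightarrow> (\<lambda>k. (F ^^ k) x) \<longlonglongrightarrow> p"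
proof -
  have FW: "F z \<in> W" if "z \<in> W" for z
    using margin[OF that] \<open>0 < \<epsilon>\<close> by auto
  obtain M q where M: "0 < M" "0 < q" "q < 1"
    "\<And>x r k. cball x r \<subseteq> W \<Longrightarrow> 0 < r \<Longrightarrow> norm (deriv (F ^^ k) x) \<le> M / r * q ^ k"
    by (rule funpow_deriv_bound[OF W(1,3) F \<open>0 < \<epsilon>\<close> margin]) auto
  have holFk: "(F ^^ k) holomorphic_on W" for k
    using F FW by (rule holomorphic_on_funpow)
  \<comment> \<open>\<open>W\<close> need not be convex, so the constant \<open>C\<close> is allowed
    to depend on the pair. Then \<open>R\<close> is an equivalence relation that holds locally, and
    connectedness leaves a single class.\<close>
  define R where "R = (\<lambda>x y. \<exists>C. \<forall>k. norm ((F ^^ k) x - (F ^^ k) y) \<le> C * q ^ k)"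
  have R: "R a b" if "a \<in> W" "b \<in> W" for a b
  proof (rule connected_equivalence_relation[OF W(2) that, of R])
    show "R y x" if "R x y" for x y
      using that unfolding R_def by (simp add: norm_minus_commute)
    show "R x z" if "R x y" "R y z" for x y z
    proof -
      obtain C where C: "\<And>k. norm ((F ^^ k) x - (F ^^ k) y) \<le> C * q ^ k"
        using \<open>R x y\<close> unfolding R_def by blast
      obtain D where D: "\<And>k. norm ((F ^^ k) y - (F ^^ k) z) \<le> D * q ^ k"
        using \<open>R y z\<close> unfolding R_def by blast
      have "norm ((F ^^ k) x - (F ^^ k) z) \<le> (C + D) * q ^ k" for k
        using norm_triangle_le[OF add_mono[OF C[of k] D[of k]]]
        by (simp add: algebra_simps)
      then show ?thesis unfolding R_def by blast
    qed
    show "\<exists>T. openin (top_of_set W) T \<and> x \<in> T \<and> (\<forall>y\<in>T. R x y)" if "x \<in> W" for x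
    proof -
      \<comment> \<open>The radius \<open>2 * r\<close> gives every point of \<open>ball x r\<close>
        a closed disc of radius \<open>r\<close> inside \<open>W\<close>, so one derivative bound
        serves the whole ball.\<close>
      obtain r where r: "0 < r" "cball x (2 * r) \<subseteq> W"
      proof -
        obtain e where "0 < e" "cball x e \<subseteq> W" using W(1) \<open>x \<in> W\<close> open_contains_cball by blast
        then show ?thesis using that[of "e / 2"] by simp
      qed
      have sub: "cball y r \<subseteq> W" if "y \<in> ball x r" for y
      proof
        fix z assume "z \<in> cball y r"
        then have "dist x z \<le> 2 * r"
          using that dist_triangle[of x z y] by auto
        then show "z \<in> W" using r by auto
      qed
      have "norm ((F ^^ k) x - (F ^^ k) y) \<le> (M / r * norm (x - y)) * q ^ k"
        if "y \<in> ball x r" for y k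
      proof -
        have "norm ((F ^^ k) x - (F ^^ k) y) \<le> (M / r * q ^ k) * norm (x - y)"
        proof (rule field_differentiable_bound[of "ball x r"])
          show "((F ^^ k) has_field_derivative deriv (F ^^ k) z) (at z within ball x r)"
            if "z \<in> ball x r" for z
          proof -
            have "z \<in> W" using subsetD[OF sub[OF that] centre_in_cball[THEN iffD2]] r(1) by simp
            then show ?thesis
              using holomorphic_derivI[OF holFk W(1)] has_field_derivative_at_within by blast
          qed
          show "norm (deriv (F ^^ k) z) \<le> M / r * q ^ k" if "z \<in> ball x r" for z
            using sub[OF that] r(1) by (rule M(4))
        qed (use that r in auto)
        then show ?thesis by (simp add: mult_ac)
      qed
      then have "\<forall>y\<in>ball x r. R x y" unfolding R_def by blast
      moreover have "openin (top_of_set W) (ball x r)"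
      proof (rule open_openin_trans[OF W(1) open_ball])
        show "ball x r \<subseteq> W"
          using r by (intro order_trans[OF ball_subset_cball order_trans[OF subset_cball r(2)]]) simp
      qed
      ultimately show ?thesis using r(1) by (intro exI[of _ "ball x r"]) auto
    qed
  qed
  obtain x0 where x0: "x0 \<in> W" using W(4) by blast
  obtain C where C: "\<And>k. norm ((F ^^ k) x0 - (F ^^ k) (F x0)) \<le> C * q ^ k"
    using R[OF x0 FW[OF x0]] unfolding R_def by blast
  have sum: "summable (\<lambda>k. (F ^^ Suc k) x0 - (F ^^ k) x0)"
  proof (rule summable_comparison_test)
    show "\<exists>N. \<forall>k\<ge>N. norm ((F ^^ Suc k) x0 - (F ^^ k) x0) \<le> C * q ^ k"
      using C by (simp add: funpow_swap1 norm_minus_commute)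
    show "summable (\<lambda>k. C * q ^ k)"
      using M(1-3) by (intro summable_mult summable_geometric) auto
  qed
  obtain p where p: "(\<lambda>k. (F ^^ k) x0) \<longlonglongrightarrow> p"
  proof -
    have "(\<Sum>i<k. (F ^^ Suc i) x0 - (F ^^ i) x0) = (F ^^ k) x0 - x0" for k
      using sum_lessThan_telescope[of "\<lambda>i. (F ^^ i) x0" k] by simp
    then have "(\<lambda>k. (F ^^ k) x0 - x0) \<longlonglongrightarrow> (\<Sum>i. (F ^^ Suc i) x0 - (F ^^ i) x0)"
      using summable_LIMSEQ[OF sum] by (simp only:)
    from tendsto_add[OF this tendsto_const[of x0]] show ?thesis using that by simp
  qed
  \<comment> \<open>A limit a priori lies only in the closure of \<open>W\<close>; but
    \<open>p\<close> is within \<open>\<epsilon>\<close> of the image of an orbit point, and the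
    margin applies there.\<close>
  have "p \<in> W"
  proof -
    have "\<forall>\<^sub>F k in sequentially. dist ((F ^^ Suc k) x0) p < \<epsilon>"
      using LIMSEQ_Suc[OF p] \<open>0 < \<epsilon>\<close> by (rule tendstoD)
    then obtain k where k: "dist ((F ^^ Suc k) x0) p < \<epsilon>"
      by (auto simp: eventually_sequentially)
    have "(F ^^ k) x0 \<in> W" using funpow_in_invariant[of W F] FW x0 by blast
    then show ?thesis using margin k by force
  qed
  have lim: "(\<lambda>k. (F ^^ k) x) \<longlonglongrightarrow> p" if "x \<in> W" for x
  proof -
    obtain D where D: "\<And>k. norm ((F ^^ k) x - (F ^^ k) x0) \<le> D * q ^ k"
      using R[OF \<open>x \<in> W\<close> x0] unfolding R_def by blast
    have "(\<lambda>k. D * q ^ k) \<longlonglongrightarrow> D * 0"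
      using M(1-3) by (intro tendsto_intros LIMSEQ_power_zero) auto
    then have "(\<lambda>k. (F ^^ k) x - (F ^^ k) x0) \<longlonglongrightarrow> 0"
      using Lim_null_comparison[OF always_eventually[OF allI[OF D]]] by simp
    from tendsto_add[OF this p] show ?thesis by simp
  qed
  have "F p = p"
  proof (rule LIMSEQ_unique)
    show "(\<lambda>k. (F ^^ Suc k) x0) \<longlonglongrightarrow> p" using p by (rule LIMSEQ_Suc)
    have "isCont F p"
      using holomorphic_on_imp_continuous_on[OF F] W(1) \<open>p \<in> W\<close>
      by (simp add: continuous_on_eq_continuous_at)
    then show "(\<lambda>k. (F ^^ Suc k) x0) \<longlonglongrightarrow> F p"
      using isCont_tendsto_compose[OF _ p] by simp
  qed
  have "norm (deriv F p) < 1"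
  proof (rule ccontr)
    assume "\<not> norm (deriv F p) < 1"
    obtain r where r: "0 < r" "cball p r \<subseteq> W"
      using W(1) \<open>p \<in> W\<close> open_contains_cball by blast
    have "(\<lambda>k. M / r * q ^ k) \<longlonglongrightarrow> M / r * 0"
      using M(1-3) by (intro tendsto_intros LIMSEQ_power_zero) auto
    then have "\<forall>\<^sub>F k in sequentially. M / r * q ^ k < 1"
      by (rule order_tendstoD) auto
    then obtain k where k: "M / r * q ^ k < 1"
      by (auto simp: eventually_sequentially)
    \<comment> \<open>At the fixed point the derivative of the \<open>k\<close>-th iterate is the
      \<open>k\<close>-th power of the multiplier, so the geometric decay excludes modulus at least
      1.\<close>
    have "norm (deriv F p) ^ k \<le> M / r * q ^ k"
      using M(4)[OF r(2,1), of k]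
        DERIV_imp_deriv[OF deriv_funpow_at_fixpoint[OF F W(1) \<open>p \<in> W\<close> \<open>F p = p\<close>, of k]]
      by (simp add: norm_power)
    moreover have "norm (deriv F p) ^ k \<ge> 1"
      using \<open>\<not> norm (deriv F p) < 1\<close> by (simp add: one_le_power)
    ultimately show False using k by linarith
  qed
  then show ?thesis using that \<open>p \<in> W\<close> \<open>F p = p\<close> lim by blast
qed

subsection \<open>Bounded pseudo-orbits\<close>

text \<open>Reaching \<open>u\<close> in the least possible number of steps keeps the earlier orbit away from \<open>u\<close>, so the
  map can be changed near \<open>u\<close> without affecting how \<open>u\<close> is reached.\<close>

lemma uniformly_close_orbits_step:
  fixes f :: "'a::real_normed_vector \<Rightarrow> 'a" and x0 :: 'a and \<epsilon> :: real
  assumes f: "continuous_on UNIV f"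
  defines "R \<equiv> {u. \<exists>g N. continuous_on UNIV g \<and> (\<forall>x. dist (g x) (f x) < \<epsilon>) \<and> (g ^^ N) x0 = u}"
  assumes "u \<in> R"
  shows "ball (f u) \<epsilon> \<subseteq> R"
proof
  fix v assume v: "v \<in> ball (f u) \<epsilon>"
  define P where "P = (\<lambda>N. \<exists>g. continuous_on UNIV g \<and> (\<forall>x. dist (g x) (f x) < \<epsilon>) \<and> (g ^^ N) x0 = u)"
  have "\<exists>N. P N" using \<open>u \<in> R\<close> unfolding R_def P_def by blast
  define N where "N = (LEAST N. P N)"
  have "P N" unfolding N_def using \<open>\<exists>N. P N\<close> by (rule LeastI_ex)
  then obtain g where g: "continuous_on UNIV g" "\<And>x. dist (g x) (f x) < \<epsilon>" "(g ^^ N) x0 = u"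
    unfolding P_def by blast
  have new: "(g ^^ i) x0 \<noteq> u" if "i < N" for i
  proof -
    have "\<not> P i" using not_less_Least that unfolding N_def by blast
    then show ?thesis using g(1,2) unfolding P_def by blast
  qed
  define F where "F = (\<lambda>i. (g ^^ i) x0) ` {..<N}"
  have "finite F" "u \<notin> F" using new unfolding F_def by auto
  then obtain d where d: "0 < d" "\<And>x. x \<in> F \<Longrightarrow> d \<le> dist u x"
    using finite_set_avoid[of F u] by metis
  define b where "b = (\<lambda>x. max 0 (1 - dist u x / d))"
  define h where "h = (\<lambda>x. (1 - b x) *\<^sub>R g x + b x *\<^sub>R (f x + (v - f u)))"
  have b: "0 \<le> b x" "b x \<le> 1" for x unfolding b_def using d(1) by auto
  have "continuous_on UNIV h"
    unfolding h_def b_def using d(1) by (intro continuous_intros f g(1)) auto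
  moreover have "dist (h x) (f x) < \<epsilon>" for x
  proof -
    have "h x - f x = (1 - b x) *\<^sub>R (g x - f x) + b x *\<^sub>R (v - f u)"
      by (simp add: h_def algebra_simps)
    moreover have "(1 - b x) *\<^sub>R (g x - f x) + b x *\<^sub>R (v - f u) \<in> ball 0 \<epsilon>"
      using g(2)[of x] v b[of x]
      by (intro convexD[OF convex_ball]) (auto simp: dist_norm norm_minus_commute)
    ultimately show ?thesis by (simp only: mem_ball_0 dist_norm)
  qed
  moreover have "(h ^^ Suc N) x0 = v"
  proof -
    have "(h ^^ i) x0 = (g ^^ i) x0" if "i \<le> N" for i
      using that
    proof (induction i)
      case (Suc i)
      then have "(g ^^ i) x0 \<in> F" unfolding F_def by auto
      from d(2)[OF this] have "b ((g ^^ i) x0) = 0" using d(1) unfolding b_def by simp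
      then show ?case using Suc by (simp add: h_def)
    qed simp
    then have "(h ^^ N) x0 = u" using g(3) by simp
    moreover have "b u = 1" by (simp add: b_def)
    ultimately show ?thesis by (simp add: h_def)
  qed
  ultimately show "v \<in> R" unfolding R_def by blast
qed

text \<open>Boundedness forces the orbit of \<open>f x0\<close> to come back close to itself. The
  component \<open>W\<close> of \<open>U\<close> in which this happens is then mapped into itself,
  with margin \<open>\<epsilon>\<close>, by the iterate of that return time.\<close>

lemma bounded_pseudo_orbits_imp_attracting_cycle:
  fixes f :: "complex \<Rightarrow> complex"
  assumes f: "f holomorphic_on UNIV" and "0 < \<epsilon>" "bounded B"
    and B: "\<And>g k. continuous_on UNIV g \<Longrightarrow> (\<And>x. dist (g x) (f x) < \<epsilon>) \<Longrightarrow> (g ^^ k) x0 \<in> B"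
  obtains n p where "n \<ge> 1" "(f ^^ n) p = p" "norm (deriv (f ^^ n) p) < 1"
proof -
  have contf: "continuous_on UNIV f" using f by (rule holomorphic_on_imp_continuous_on)
  define R where "R = {u. \<exists>g N. continuous_on UNIV g \<and> (\<forall>x. dist (g x) (f x) < \<epsilon>) \<and> (g ^^ N) x0 = u}"
  \<comment> \<open>\<open>R\<close> may fail to be open at the starting point \<open>x0\<close>.
    \<open>U\<close> is an open subset of \<open>R\<close> that still contains the
    \<open>\<epsilon>\<close>-ball about the image of each of its points.\<close>
  define U where "U = (\<Union>u\<in>R. ball (f u) \<epsilon>)"
  have step: "ball (f u) \<epsilon> \<subseteq> R" if "u \<in> R" for u
    using uniformly_close_orbits_step[OF contf, of u \<epsilon> x0] that unfolding R_def by blast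
  have "R \<subseteq> B" unfolding R_def using B by blast
  have "x0 \<in> R"
    unfolding R_def using contf \<open>0 < \<epsilon>\<close> by (intro CollectI exI[of _ f] exI[of _ 0]) simp
  have "U \<subseteq> R" using step unfolding U_def by blast
  have "open U" unfolding U_def by blast
  have ballU: "ball (f u) \<epsilon> \<subseteq> U" if "u \<in> U" for u
    using that \<open>U \<subseteq> R\<close> unfolding U_def by blast
  have "f x0 \<in> U" using \<open>x0 \<in> R\<close> \<open>0 < \<epsilon>\<close> unfolding U_def by force
  define s where "s = (\<lambda>k. (f ^^ k) (f x0))"
  have fU: "f u \<in> U" if "u \<in> U" for u
    using ballU[OF that] \<open>0 < \<epsilon>\<close> by auto
  have sU: "s k \<in> U" for k
    unfolding s_def using funpow_in_invariant[of U f] fU \<open>f x0 \<in> U\<close> by blast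
  have "bounded (range s)"
    using \<open>bounded B\<close> sU \<open>U \<subseteq> R\<close> \<open>R \<subseteq> B\<close> by (meson bounded_subset image_subsetI subset_trans subsetD)
  then obtain l r where r: "strict_mono (r :: nat \<Rightarrow> nat)" "(s \<circ> r) \<longlonglongrightarrow> l"
    using bounded_imp_convergent_subsequence by blast
  have "Cauchy (s \<circ> r)" using r(2) by (rule LIMSEQ_imp_Cauchy)
  then obtain M where M: "\<And>m n. m \<ge> M \<Longrightarrow> n \<ge> M \<Longrightarrow> dist ((s \<circ> r) m) ((s \<circ> r) n) < \<epsilon>"
    using \<open>0 < \<epsilon>\<close> unfolding Cauchy_def by blast
  \<comment> \<open>Taking \<open>Suc M\<close> instead of \<open>M\<close> forces
    \<open>i > 0\<close>, so \<open>s i\<close> is the image of a point of \<open>U\<close> and its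
    whole \<open>\<epsilon>\<close>-ball lies in \<open>U\<close>.\<close>
  define i where "i = r (Suc M)"
  define j where "j = r (Suc (Suc M))"
  have "i < j" unfolding i_def j_def using r(1) by (simp add: strict_mono_def)
  have "0 < i" using strict_mono_imp_increasing[OF r(1), of "Suc M"] by (simp add: i_def)
  have close: "dist (s i) (s j) < \<epsilon>" using M[of "Suc M" "Suc (Suc M)"] by (simp add: i_def j_def)
  define W where "W = connected_component_set U (s i)"
  have W: "open W" "connected W" "W \<subseteq> U" "s i \<in> W"
    unfolding W_def using \<open>open U\<close> sU
    by (auto simp: open_connected_component connected_component_subset)
  have maxW: "T \<subseteq> W" if "connected T" "T \<subseteq> U" "x \<in> T" "x \<in> W" for T x
    using that connected_component_maximal[of x T U] connected_component_eq[of x U "s i"]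
    unfolding W_def by metis
  have ballW: "ball w \<epsilon> \<subseteq> W" if "w \<in> W" "u \<in> U" "w = f u" for w u
    using maxW[of "ball w \<epsilon>" w] ballU[of u] that \<open>0 < \<epsilon>\<close> by simp
  have "s j \<in> W"
  proof -
    have "s i = f (s (i - 1))" using \<open>0 < i\<close> by (cases i) (simp_all add: s_def)
    then have "ball (s i) \<epsilon> \<subseteq> W" using ballW[OF W(4) sU[of "i - 1"]] by simp
    then show ?thesis using close by auto
  qed
  define n where "n = j - i"
  have "n \<ge> 1" using \<open>i < j\<close> by (simp add: n_def)
  have fn: "(f ^^ n) holomorphic_on S" for S
    using holomorphic_on_subset[OF holomorphic_on_funpow[OF f]] by simp
  have "(f ^^ n) ` W \<subseteq> W"
  proof (rule maxW)
    show "connected ((f ^^ n) ` W)"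
      using fn W(2) by (intro connected_continuous_image holomorphic_on_imp_continuous_on)
    show "(f ^^ n) ` W \<subseteq> U"
      using W(3) funpow_in_invariant[of U f] fU by blast
    have "(f ^^ n) (s i) = s j"
      using \<open>i < j\<close> funpow_add[of n i f] by (simp add: n_def s_def)
    then show "s j \<in> (f ^^ n) ` W" using W(4) by force
  qed fact
  \<comment> \<open>The last of the \<open>n\<close> steps starts in \<open>U\<close>, so the ball
    around its endpoint lies in \<open>U\<close>; being connected and meeting \<open>W\<close>, it
    lies in \<open>W\<close>.\<close>
  then have "ball ((f ^^ n) z) \<epsilon> \<subseteq> W" if "z \<in> W" for z
  proof -
    have eq: "(f ^^ n) z = f ((f ^^ (n - 1)) z)" using \<open>n \<ge> 1\<close> by (cases n) simp_all
    have "(f ^^ (n - 1)) z \<in> U"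
      using W(3) that funpow_in_invariant[of U f] fU by blast
    with \<open>(f ^^ n) ` W \<subseteq> W\<close> that show ?thesis by (intro ballW[OF _ _ eq]) auto
  qed
  moreover have "bounded W"
    using \<open>bounded B\<close> W(3) \<open>U \<subseteq> R\<close> \<open>R \<subseteq> B\<close> by (meson bounded_subset)
  ultimately obtain p where "(f ^^ n) p = p" "norm (deriv (f ^^ n) p) < 1"
    using strictly_inside_imp_attracting_fixpoint[OF W(1,2) _ _ fn \<open>0 < \<epsilon>\<close>] W(4) by blast
  then show ?thesis using that \<open>n \<ge> 1\<close> by blast
qed

subsection \<open>Iteration of quadratic polynomials\<close>

text \<open>Parameter and starting point may both vary: this covers iterates in \<open>z\<close>,
  the critical orbit as a function of \<open>c\<close>, and multipliers along a moving periodic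
  point.\<close>

lemma holomorphic_on_quad_funpow:
  assumes "a holomorphic_on S" "w holomorphic_on S"
  shows "(\<lambda>z. (quad (a z) ^^ n) (w z)) holomorphic_on S"
proof (induction n)
  case (Suc n)
  then show ?case by (simp add: quad_def) (intro holomorphic_intros assms(1))
qed (simp add: assms)

lemma holomorphic_on_quad_iterate: "(quad c ^^ n) holomorphic_on S"
  using holomorphic_on_quad_funpow[of "\<lambda>_. c" S "\<lambda>z. z" n] by simp

lemma continuous_on_quad: "continuous_on S (quad c)"
  unfolding quad_def by (intro continuous_intros)

lemma deriv_quad_funpow: "deriv (quad c ^^ n) z = (\<Prod>i<n. 2 * (quad c ^^ i) z)"
proof -
  have "((quad c ^^ n) has_field_derivative (\<Prod>i<n. 2 * (quad c ^^ i) z)) (at z)"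
  proof (induction n)
    case (Suc n)
    have "(quad c has_field_derivative 2 * w) (at w)" for w
      unfolding quad_def by (auto intro!: derivative_eq_intros)
    from DERIV_chain[OF this Suc] show ?case by (simp add: o_def mult.commute)
  qed (simp add: id_def)
  then show ?thesis by (rule DERIV_imp_deriv)
qed

text \<open>Each step factors a difference of squares. As \<open>z\<close> tends to
  \<open>w\<close>, the product tends to the chain-rule product of
  \<open>deriv_quad_funpow\<close>.\<close>

lemma quad_funpow_diff:
  "(quad c ^^ n) z - (quad c ^^ n) w = (z - w) * (\<Prod>i<n. (quad c ^^ i) z + (quad c ^^ i) w)"
proof (induction n)
  case (Suc n)
  have "(quad c ^^ Suc n) z - (quad c ^^ Suc n) w =
      ((quad c ^^ n) z - (quad c ^^ n) w) * ((quad c ^^ n) z + (quad c ^^ n) w)"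
    by (simp add: quad_def power2_eq_square algebra_simps)
  then show ?case by (simp add: Suc)
qed simp

section \<open>Escape estimates for large parameters and large points\<close>

lemma exponential_growth_unbounded:
  fixes x :: "nat \<Rightarrow> 'a::real_normed_vector"
  assumes "1 < b" "0 < (a::real)" "\<And>k. b ^ k * a \<le> norm (x k)"
  shows "\<not> bounded (range x)"
proof
  assume "bounded (range x)"
  then obtain B where B: "\<And>k. norm (x k) \<le> B" unfolding bounded_iff by blast
  obtain k where "B / a < b ^ k" using real_arch_pow[OF \<open>1 < b\<close>] by blast
  then have "B < b ^ k * a" using \<open>0 < a\<close> by (simp add: pos_divide_less_eq)
  then show False using assms(3)[of k] B[of k] by linarith
qed

text \<open>If \<open>norm c > 2\<close>, then \<open>norm z \<ge> norm c\<close> implies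
  \<open>norm (quad c z) \<ge> (norm c - 1) * norm z\<close>, so the critical orbit grows
  geometrically from its first value \<open>c\<close> on.\<close>

lemma mandelbrot_norm_le:
  assumes "c \<in> mandelbrot"
  shows "norm c \<le> 2"
proof (rule ccontr)
  assume "\<not> norm c \<le> 2"
  then have c: "norm c > 2" by simp
  have "(norm c - 1) ^ k * norm c \<le> norm ((quad c ^^ Suc k) 0)" for k
  proof (induction k)
    case (Suc k)
    define z where "z = (quad c ^^ Suc k) 0"
    have "1 \<le> (norm c - 1) ^ k" using c by (intro one_le_power) simp
    then have "norm c \<le> norm z"
      using Suc c mult_right_mono[of 1 "(norm c - 1) ^ k" "norm c"] unfolding z_def by linarith
    then have "(norm c - 1) * norm z \<le> norm z * norm z - norm c"
      using c mult_right_mono[of "norm c" "norm z" "norm z"] by (simp add: algebra_simps)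
    also have "\<dots> \<le> norm (quad c z)"
      using norm_diff_ineq[of "z\<^sup>2" c] by (simp add: quad_def norm_power power2_eq_square norm_mult)
    finally have "(norm c - 1) * norm z \<le> norm (quad c z)" .
    moreover have "(norm c - 1) ^ Suc k * norm c \<le> (norm c - 1) * norm z"
      using mult_left_mono[OF Suc, of "norm c - 1"] c unfolding z_def by (simp add: mult.assoc)
    ultimately show ?case unfolding z_def by simp
  qed (simp add: quad_def)
  then have "\<not> bounded (range (\<lambda>k. (quad c ^^ Suc k) 0))"
    using c by (intro exponential_growth_unbounded[of "norm c - 1" "norm c"]) auto
  moreover have "bounded (range (\<lambda>k. (quad c ^^ Suc k) 0))"
    using assms unfolding mandelbrot_def by (auto elim!: bounded_subset intro: range_eqI[of _ _ "Suc _"])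
  ultimately show False by blast
qed

text \<open>Outside the disc of radius 2 the excess \<open>norm v - 2\<close> grows at least
  fourfold per step. The starting point is arbitrary because the bound also serves inverse branches
  and trapping discs.\<close>

lemma bounded_quad_orbit_norm_le:
  assumes "norm c \<le> 2" "bounded (range (\<lambda>k. (quad c ^^ k) z))"
  shows "norm ((quad c ^^ n) z) \<le> 2"
proof (rule ccontr)
  define w where "w = (quad c ^^ n) z"
  assume "\<not> norm ((quad c ^^ n) z) \<le> 2"
  then have w: "norm w > 2" by (simp add: w_def)
  have "4 ^ k * (norm w - 2) \<le> norm ((quad c ^^ k) w) - 2" for k
  proof (induction k)
    case (Suc k)
    define v where "v = (quad c ^^ k) w"
    have "0 \<le> 4 ^ k * (norm w - 2)" using w by simp
    then have v: "norm v \<ge> 2" using Suc unfolding v_def by linarith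
    have "4 * (norm v - 2) \<le> (norm v + 2) * (norm v - 2)"
      using v by (intro mult_right_mono) auto
    also have "\<dots> = norm v * norm v - 2 - 2" by (simp add: algebra_simps)
    also have "norm v * norm v - 2 \<le> norm (quad c v)"
      using norm_diff_ineq[of "v\<^sup>2" c] assms(1)
      by (simp add: quad_def norm_power power2_eq_square norm_mult)
    finally have "4 * (norm v - 2) \<le> norm (quad c v) - 2" by simp
    then show ?case using Suc unfolding v_def by simp
  qed simp
  then have "4 ^ k * (norm w - 2) \<le> norm ((quad c ^^ k) w)" for k
    by (smt (verit))
  then have "\<not> bounded (range (\<lambda>k. (quad c ^^ k) w))"
    using w by (intro exponential_growth_unbounded[of 4 "norm w - 2"]) auto
  moreover have "(quad c ^^ k) w = (quad c ^^ (k + n)) z" for k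
    by (simp add: w_def funpow_add)
  then have "range (\<lambda>k. (quad c ^^ k) w) \<subseteq> range (\<lambda>k. (quad c ^^ k) z)" by auto
  then have "bounded (range (\<lambda>k. (quad c ^^ k) w))" using assms(2) bounded_subset by blast
  ultimately show False by blast
qed

lemma mandelbrot_orbit_norm_le:
  assumes "c \<in> mandelbrot"
  shows "norm ((quad c ^^ n) 0) \<le> 2"
  using bounded_quad_orbit_norm_le[OF mandelbrot_norm_le[OF assms]] assms
  unfolding mandelbrot_def by blast

text \<open>The period \<open>n\<close> need not be minimal here: by the chain rule the multiplier along \<open>n\<close> steps is a
  power of the multiplier of the cycle.\<close>

lemma has_attracting_cycleI:
  assumes f: "f holomorphic_on UNIV" and "n \<ge> 1" "(f ^^ n) z = z" "norm (deriv (f ^^ n) z) < 1"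
  shows "has_attracting_cycle f"
proof -
  define P where "P = (\<lambda>m. m \<ge> 1 \<and> (f ^^ m) z = z)"
  define m where "m = (LEAST m. P m)"
  have "P n" using assms by (simp add: P_def)
  then have "P m" unfolding m_def by (rule LeastI)
  have least: "\<not> P k" if "k < m" for k using not_less_Least that unfolding m_def by blast
  have no_period: "(f ^^ k) z \<noteq> z" if "1 \<le> k" "k < m" for k
    using least[OF that(2)] that(1) unfolding P_def by blast
  have "inj_on (\<lambda>j. (f ^^ j) z) {..<m}"
  proof (rule linorder_inj_onI')
    fix i j assume "i \<in> {..<m}" "j \<in> {..<m}" "i < j"
    show "(f ^^ i) z \<noteq> (f ^^ j) z"
    proof
      assume "(f ^^ i) z = (f ^^ j) z"
      \<comment> \<open>Another \<open>m - j\<close> steps turn the coincidence into a return to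
        \<open>z\<close> after \<open>m - j + i < m\<close> steps.\<close>
      then have "(f ^^ (m - j)) ((f ^^ i) z) = (f ^^ (m - j)) ((f ^^ j) z)" by simp
      then have "(f ^^ (m - j + i)) z = (f ^^ (m - j + j)) z" by (simp only: funpow_add o_apply)
      then have "(f ^^ (m - j + i)) z = z"
        using \<open>P m\<close> \<open>j \<in> {..<m}\<close> by (simp add: P_def)
      moreover have "1 \<le> m - j + i" "m - j + i < m"
        using \<open>i < j\<close> \<open>j \<in> {..<m}\<close> by auto
      ultimately show False using no_period by blast
    qed
  qed
  moreover have "norm (deriv (f ^^ m) z) < 1"
  proof (rule ccontr)
    assume "\<not> norm (deriv (f ^^ m) z) < 1"
    have fm: "(f ^^ m) z = z" using \<open>P m\<close> by (simp add: P_def)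
    then have fmk: "((f ^^ m) ^^ k) z = z" for k by (rule funpow_fixpoint)
    \<comment> \<open>This shows that \<open>m\<close> divides \<open>n\<close>: the orbit also
      returns to \<open>z\<close> after \<open>n mod m\<close> steps, and a positive remainder would
      undercut the least period.\<close>
    have "(f ^^ (n mod m)) z = (f ^^ (n mod m)) (((f ^^ m) ^^ (n div m)) z)" by (simp add: fmk)
    also have "\<dots> = (f ^^ (n mod m + m * (n div m))) z"
      by (simp only: funpow_add funpow_mult o_apply mult.commute)
    also have "\<dots> = z" using assms(3) by simp
    finally have "\<not> 1 \<le> n mod m" using no_period[of "n mod m"] \<open>P m\<close> by (auto simp: P_def)
    then have "n mod m = 0" by simp
    then have "f ^^ n = (f ^^ m) ^^ (n div m)"
      by (metis funpow_mult mult.commute mult_div_mod_eq add_0_right)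
    moreover have "(f ^^ m) holomorphic_on UNIV" using f by (rule holomorphic_on_funpow) simp
    ultimately have "deriv (f ^^ n) z = deriv (f ^^ m) z ^ (n div m)"
      using deriv_funpow_at_fixpoint[of "f ^^ m" UNIV z "n div m"] fm by (simp add: DERIV_imp_deriv)
    then have "norm (deriv (f ^^ m) z) ^ (n div m) < 1" using assms(4) by (simp add: norm_power)
    moreover have "1 \<le> norm (deriv (f ^^ m) z)" using \<open>\<not> norm (deriv (f ^^ m) z) < 1\<close> by simp
    from one_le_power[OF this, of "n div m"] have "1 \<le> norm (deriv (f ^^ m) z) ^ (n div m)" .
    ultimately show False by linarith
  qed
  ultimately show ?thesis
    using \<open>P m\<close> unfolding has_attracting_cycle_def P_def by blast
qed

subsection \<open>Attracting cycles and the critical orbit\<close>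

text \<open>The difference quotient at \<open>z\<close> tends to the multiplier; the midpoint
  between its modulus and 1 serves as contraction rate.\<close>

lemma attracting_fixpoint_contracts:
  fixes f :: "complex \<Rightarrow> complex"
  assumes "f field_differentiable (at z)" "f z = z" "norm (deriv f z) < 1"
  obtains r \<mu> where "0 < r" "0 \<le> \<mu>" "\<mu> < 1"
    "\<And>w. w \<in> cball z r \<Longrightarrow> norm (f w - z) \<le> \<mu> * norm (w - z)"
proof -
  define \<mu> where "\<mu> = (norm (deriv f z) + 1) / 2"
  have \<mu>: "0 \<le> \<mu>" "\<mu> < 1" "norm (deriv f z) < \<mu>" using assms(3) unfolding \<mu>_def by auto
  have "(f has_field_derivative deriv f z) (at z)"
    using assms(1) by (simp add: field_differentiable_derivI)
  then have "((\<lambda>w. norm ((f w - f z) / (w - z))) \<longlongrightarrow> norm (deriv f z)) (at z)"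
    unfolding has_field_derivative_iff by (rule tendsto_norm)
  then have "\<forall>\<^sub>F w in at z. norm ((f w - f z) / (w - z)) < \<mu>"
    using \<mu>(3) by (rule order_tendstoD)
  then obtain d where d: "0 < d" "\<And>w. w \<noteq> z \<Longrightarrow> dist w z < d \<Longrightarrow> norm ((f w - f z) / (w - z)) < \<mu>"
    unfolding eventually_at by blast
  have "norm (f w - z) \<le> \<mu> * norm (w - z)" if "w \<in> cball z (d / 2)" for w
  proof (cases "w = z")
    case False
    have "dist w z < d" using that d(1) by (auto simp: dist_commute)
    then have "norm (f w - z) / norm (w - z) < \<mu>"
      using d(2)[OF False] assms(2) by (simp add: norm_divide)
    then show ?thesis using False by (simp add: pos_divide_less_eq)
  qed (simp add: assms(2))
  then show ?thesis using that[of "d / 2" \<mu>] d(1) \<mu> by simp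
qed

text \<open>One more step is inverted by a holomorphic square root of \<open>g z - c\<close>. It
  exists because \<open>g z = c\<close> would make \<open>z\<close> a point of the critical orbit,
  which avoids the disc.\<close>

lemma quad_inverse_branch:
  assumes avoid: "\<And>i. (quad c ^^ i) 0 \<notin> ball z0 r" and "0 < r" "(quad c ^^ k) y = z0"
  obtains g where "g holomorphic_on ball z0 r" "g z0 = y"
    "\<And>z. z \<in> ball z0 r \<Longrightarrow> (quad c ^^ k) (g z) = z"
  using assms(3)
proof (induction k arbitrary: y thesis)
  case 0
  then show ?case by (intro "0.prems"(1)[of "\<lambda>z. z"]) (auto simp: holomorphic_on_ident)
next
  case (Suc k)
  have "(quad c ^^ k) (quad c y) = z0" using Suc.prems(2) by (simp add: funpow_swap1)
  then obtain g where g: "g holomorphic_on ball z0 r" "g z0 = quad c y"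
      "\<And>z. z \<in> ball z0 r \<Longrightarrow> (quad c ^^ k) (g z) = z"
    using Suc.IH by blast
  have "g z - c \<noteq> 0" if "z \<in> ball z0 r" for z
  proof
    assume "g z - c = 0"
    then have "(quad c ^^ Suc k) 0 = z" using g(3)[OF that] by (simp add: funpow_swap1 quad_def)
    then show False using avoid[of "Suc k"] that by simp
  qed
  moreover have "(\<lambda>z. g z - c) holomorphic_on ball z0 r"
    by (intro holomorphic_intros g(1))
  ultimately obtain s where
      s: "s holomorphic_on ball z0 r" "\<And>z. z \<in> ball z0 r \<Longrightarrow> g z - c = (s z)\<^sup>2"
    using contractible_imp_holomorphic_sqrt[of "\<lambda>z. g z - c" "ball z0 r"]
      convex_imp_contractible[OF convex_ball] by blast
  \<comment> \<open>The root is fixed only up to sign; \<open>e\<close> is the sign for which the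
    branch passes through \<open>y\<close>.\<close>
  have "(s z0)\<^sup>2 = y\<^sup>2" using s(2)[of z0] g(2) \<open>0 < r\<close> by (simp add: quad_def)
  then obtain e where e: "e\<^sup>2 = (1::complex)" "e * s z0 = y"
    using power2_eq_iff[of "s z0" y] by (metis minus_mult_left mult_1 mult_minus_left power2_minus power_one minus_minus)
  show ?case
  proof (rule Suc.prems(1)[of "\<lambda>z. e * s z"])
    show "(\<lambda>z. e * s z) holomorphic_on ball z0 r" by (intro holomorphic_intros s(1))
    show "(quad c ^^ Suc k) (e * s z) = z" if "z \<in> ball z0 r" for z
    proof -
      have "quad c (e * s z) = g z" using s(2)[OF that] e(1) by (simp add: quad_def power_mult_distrib diff_eq_eq)
      then show ?thesis using g(3)[OF that] by (simp add: funpow_swap1)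
    qed
  qed (use e in simp)
qed

text \<open>Fatou's theorem. If the critical orbit avoids a disc around \<open>z0\<close>, all inverse branches
  along the cycle exist on this disc; they are uniformly bounded, while their derivatives at the
  centre are powers of the inverse of the multiplier.\<close>

lemma critical_orbit_enters_attracting_disc:
  assumes c: "norm c \<le> 2" and "0 < r"
    and fp: "(quad c ^^ n) z0 = z0" and att: "norm (deriv (quad c ^^ n) z0) < 1"
    and bdd: "\<And>z. z \<in> ball z0 r \<Longrightarrow> bounded (range (\<lambda>k. (quad c ^^ k) z))"
  obtains j where "(quad c ^^ j) 0 \<in> ball z0 r"
proof (rule ccontr)
  assume "\<not> thesis"
  then have avoid: "(quad c ^^ i) 0 \<notin> ball z0 r" for i using that by blast
  define q where "q = norm (deriv (quad c ^^ n) z0)"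
  \<comment> \<open>The branch \<open>g\<close> inverse to \<open>F\<close> and fixing
    \<open>z0\<close> is bounded by 2, so Cauchy's estimate on radius \<open>r / 2\<close> bounds
    its derivative at \<open>z0\<close> by \<open>4 / r\<close>.\<close>
  have "1 \<le> q ^ m * (4 / r)" for m
  proof -
    define F where "F = (quad c ^^ n) ^^ m"
    have F: "F = quad c ^^ (n * m)" by (simp add: F_def funpow_mult mult.commute)
    have "F z0 = z0" unfolding F_def using fp by (rule funpow_fixpoint)
    then obtain g where g: "g holomorphic_on ball z0 r" "g z0 = z0"
        "\<And>z. z \<in> ball z0 r \<Longrightarrow> F (g z) = z"
      using quad_inverse_branch[OF avoid \<open>0 < r\<close>] unfolding F by metis
    \<comment> \<open>After \<open>n * m\<close> steps the orbit of \<open>g z\<close> continues as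
      the orbit of \<open>z\<close>. It is therefore bounded, and the escape estimate applies to
      \<open>g z\<close>.\<close>
    have bound: "norm (g z) \<le> 2" if z: "z \<in> ball z0 r" for z
    proof -
      obtain B where B: "\<And>k. norm ((quad c ^^ k) z) \<le> B"
        using bdd[OF z] unfolding bounded_iff by blast
      define B' where "B' = Max ((\<lambda>k. norm ((quad c ^^ k) (g z))) ` {..n * m})"
      have "norm ((quad c ^^ k) (g z)) \<le> max B B'" for k
      proof (cases "k \<le> n * m")
        case True
        then have "norm ((quad c ^^ k) (g z)) \<le> B'"
          unfolding B'_def by (intro Max_ge) auto
        then show ?thesis by simp
      next
        case False
        then have "(quad c ^^ k) (g z) = (quad c ^^ (k - n * m)) ((quad c ^^ (n * m)) (g z))"
          using funpow_add[of "k - n * m" "n * m" "quad c"] by simp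
        also have "\<dots> = (quad c ^^ (k - n * m)) z" using g(3)[OF z] unfolding F by simp
        finally show ?thesis using B[of "k - n * m"] by simp
      qed
      then have "bounded (range (\<lambda>k. (quad c ^^ k) (g z)))" unfolding bounded_iff by blast
      from bounded_quad_orbit_norm_le[OF c this, of 0] show ?thesis by simp
    qed
    have "norm (deriv g z0) \<le> 2 / (r / 2)"
      using g(1) bound \<open>0 < r\<close> by (intro deriv_bound_ball[of g "ball z0 r"]) auto
    moreover have "deriv F z0 * deriv g z0 = 1"
    proof -
      have "(F has_field_derivative deriv F (g z0)) (at (g z0))"
        unfolding F using holomorphic_on_quad_iterate open_UNIV by (rule holomorphic_derivI) simp
      moreover have "(g has_field_derivative deriv g z0) (at z0)"
        using g(1) \<open>0 < r\<close> by (intro holomorphic_derivI[of _ "ball z0 r"]) auto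
      ultimately have "((\<lambda>z. F (g z)) has_field_derivative deriv F z0 * deriv g z0) (at z0)"
        using DERIV_chain2[of F _ g] g(2) by simp
      moreover have "((\<lambda>z. F (g z)) has_field_derivative 1) (at z0)"
        using \<open>0 < r\<close> g(3)
        by (intro DERIV_ident[THEN has_field_derivative_transform_within_open[of _ _ _ "ball z0 r"]]) auto
      ultimately show ?thesis by (rule DERIV_unique)
    qed
    moreover have "deriv F z0 = deriv (quad c ^^ n) z0 ^ m"
      unfolding F_def using fp
      by (intro DERIV_imp_deriv deriv_funpow_at_fixpoint[OF holomorphic_on_quad_iterate open_UNIV]) auto
    ultimately have "q ^ m * norm (deriv g z0) = 1" "norm (deriv g z0) \<le> 4 / r"
      unfolding q_def by (metis norm_mult norm_one norm_power, simp)
    then show ?thesis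
      using mult_left_mono[of "norm (deriv g z0)" "4 / r" "q ^ m"] by (simp add: q_def)
  qed
  moreover have "(\<lambda>m. q ^ m * (4 / r)) \<longlonglongrightarrow> 0 * (4 / r)"
    using att unfolding q_def by (intro tendsto_intros LIMSEQ_power_zero) simp
  then have "\<forall>\<^sub>F m in sequentially. q ^ m * (4 / r) < 1"
    by (rule order_tendstoD) simp
  then obtain m where "q ^ m * (4 / r) < 1" by (auto simp: eventually_sequentially)
  ultimately show False using not_le by blast
qed

text \<open>Contraction at the periodic point yields the disc. Orbits from it stay in
  \<open>n\<close> compact images, hence are bounded; this makes Fatou's theorem applicable and
  gives the uniform bound 2.\<close>

lemma attracting_cycle_imp_trapping_disc:
  assumes c: "c \<in> mandelbrot" and "has_attracting_cycle (quad c)"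
  obtains z r n j where "n \<ge> 1" "0 < r" "(quad c ^^ n) ` cball z r \<subseteq> ball z r"
    "(quad c ^^ j) 0 \<in> ball z r" "\<And>w i. w \<in> cball z r \<Longrightarrow> norm ((quad c ^^ i) w) \<le> 2"
proof -
  obtain z n where n: "n \<ge> 1" "(quad c ^^ n) z = z" "norm (deriv (quad c ^^ n) z) < 1"
    using assms(2) unfolding has_attracting_cycle_def by blast
  have "(quad c ^^ n) field_differentiable (at z)"
    using holomorphic_on_quad_iterate[of n c UNIV] by (simp add: holomorphic_on_def)
  then obtain r \<mu> where r: "0 < r" "0 \<le> \<mu>" "\<mu> < 1"
    "\<And>w. w \<in> cball z r \<Longrightarrow> norm ((quad c ^^ n) w - z) \<le> \<mu> * norm (w - z)"
    using attracting_fixpoint_contracts[OF _ n(2,3)] by metis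
  have into: "(quad c ^^ n) w \<in> ball z r" if "w \<in> cball z r" for w
  proof -
    have "\<mu> * norm (w - z) \<le> \<mu> * r"
      using that r(2) by (intro mult_left_mono) (auto simp: dist_norm norm_minus_commute)
    also have "\<dots> < r" using r(1,3) by simp
    finally show ?thesis using r(4)[OF that] by (simp add: dist_norm norm_minus_commute)
  qed
  define S where "S = (\<Union>i<n. (quad c ^^ i) ` cball z r)"
  have "bounded S"
    unfolding S_def
    by (intro bounded_UN finite_lessThan ballI compact_imp_bounded compact_continuous_image
        holomorphic_on_imp_continuous_on[OF holomorphic_on_quad_iterate] compact_cball)
  have orbit: "(quad c ^^ k) w \<in> S" if "w \<in> cball z r" for w k
  proof -
    have "((quad c ^^ n) ^^ (k div n)) w \<in> cball z r"
      using funpow_in_invariant[of "cball z r" "quad c ^^ n"] into that ball_subset_cball by blast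
    moreover have "(quad c ^^ k) w = (quad c ^^ (k mod n)) (((quad c ^^ n) ^^ (k div n)) w)"
      using funpow_add[of "k mod n" "n * (k div n)" "quad c"] by (simp add: funpow_mult mult.commute)
    ultimately show ?thesis unfolding S_def using n(1) by (intro UN_I[of "k mod n"]) auto
  qed
  have bdd: "bounded (range (\<lambda>k. (quad c ^^ k) w))" if "w \<in> cball z r" for w
    using orbit[OF that] \<open>bounded S\<close> by (blast intro: bounded_subset)
  obtain j where "(quad c ^^ j) 0 \<in> ball z r"
    using critical_orbit_enters_attracting_disc[OF mandelbrot_norm_le[OF c] r(1) n(2,3)]
      bdd ball_subset_cball by blast
  then show ?thesis
    using that[OF n(1) r(1)] into bounded_quad_orbit_norm_le[OF mandelbrot_norm_le[OF c] bdd] by blast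
qed

text \<open>With \<open>c = 1\<close> the critical orbit is strictly increasing, so no identity between two of the
  polynomials \<open>\<lambda>c. (quad c ^^ n) 0\<close> holds.\<close>

lemma countable_critical_relation:
  assumes "a < b"
  shows "countable {c. (quad c ^^ a) 0 = (quad c ^^ b) 0}"
proof -
  define p where "p = (\<lambda>c. (quad c ^^ a) 0 - (quad c ^^ b) 0)"
  have hol: "p holomorphic_on UNIV"
    unfolding p_def by (intro holomorphic_intros holomorphic_on_quad_funpow)
  have "\<not> p constant_on UNIV"
  proof
    assume "p constant_on UNIV"
    \<comment> \<open>At \<open>c = 0\<close> the critical point is fixed, so a constant value of
      \<open>p\<close> would have to be 0.\<close>
    then have "p 1 = p 0" unfolding constant_on_def by auto
    moreover have "(quad 0 ^^ k) 0 = 0" for k by (induction k) (simp_all add: quad_def)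
    ultimately have eq: "(quad 1 ^^ a) 0 = (quad 1 ^^ b) 0" by (simp add: p_def)
    define t where "t = (\<lambda>k. ((\<lambda>x::nat. x\<^sup>2 + 1) ^^ k) 0)"
    have "(quad 1 ^^ k) 0 = of_nat (t k)" for k
      by (induction k) (simp_all add: t_def quad_def)
    then have "t a = t b" using eq by (metis of_nat_eq_iff)
    moreover have "x < x\<^sup>2 + 1" for x :: nat
      using self_le_power[of x 2] by (cases "x = 0") auto
    then have "strict_mono t" unfolding strict_mono_Suc_iff by (simp add: t_def)
    ultimately show False using assms strict_mono_eq by fastforce
  qed
  then have "countable {c \<in> UNIV. p c = 0}"
    using hol by (intro holomorphic_countable_zeros) (auto intro: fsigma_UNIV)
  then show ?thesis by (simp add: p_def)
qed

subsection \<open>Names and the topology on instances\<close>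

lemma dyadic_cube_subset_cball:
  assumes "Q \<in> dyadic_cubes n" "y \<in> Q"
  shows "Q \<subseteq> cball (y::'a::euclidean_space) (DIM('a) / 2 ^ n)"
proof
  fix p assume "p \<in> Q"
  from assms obtain x where
    "Q = {p. \<forall>i\<in>Basis. of_int (x i) / 2 ^ n \<le> p \<bullet> i \<and> p \<bullet> i \<le> (of_int (x i) + 1) / 2 ^ n}"
    unfolding dyadic_cubes_def by blast
  with assms(2) \<open>p \<in> Q\<close> have "\<bar>(y - p) \<bullet> i\<bar> \<le> 1 / 2 ^ n" if "i \<in> Basis" for i
    using that by (fastforce simp: inner_diff_left add_divide_distrib abs_le_iff)
  then have "norm (y - p) \<le> (\<Sum>i\<in>(Basis::'a set). 1 / 2 ^ n)"
    by (intro order_trans[OF norm_le_l1] sum_mono)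
  then show "p \<in> cball y (DIM('a) / 2 ^ n)" by (simp add: dist_norm)
qed

lemma closed_dyadic_cube:
  assumes "Q \<in> dyadic_cubes n"
  shows "closed (Q :: 'a::euclidean_space set)"
proof -
  from assms obtain x where
    "Q = {p. \<forall>i\<in>Basis. of_int (x i) / 2 ^ n \<le> p \<bullet> i \<and> p \<bullet> i \<le> (of_int (x i) + 1) / 2 ^ n}"
    unfolding dyadic_cubes_def by blast
  then have "Q = (\<Inter>i\<in>Basis. {p. of_int (x i) / 2 ^ n \<le> p \<bullet> i} \<inter> {p. p \<bullet> i \<le> (of_int (x i) + 1) / 2 ^ n})"
    by auto
  then show ?thesis
    by (elim ssubst, intro closed_INT ballI closed_Int closed_Collect_le continuous_intros)
qed

lemma dyadic_cubes_cover:
  obtains Q where "Q \<in> dyadic_cubes n" "(p :: 'a::euclidean_space) \<in> Q"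
proof
  let ?Q = "{q :: 'a. \<forall>i\<in>Basis. of_int \<lfloor>2 ^ n * (p \<bullet> i)\<rfloor> / 2 ^ n \<le> q \<bullet> i \<and>
              q \<bullet> i \<le> (of_int \<lfloor>2 ^ n * (p \<bullet> i)\<rfloor> + 1) / 2 ^ n}"
  show "?Q \<in> dyadic_cubes n"
    unfolding dyadic_cubes_def by (intro CollectI exI[of _ "\<lambda>i. \<lfloor>2 ^ n * (p \<bullet> i)\<rfloor>"]) simp
  show "p \<in> ?Q"
    by (simp add: divide_simps mult.commute real_of_int_floor_add_one_ge)
qed

lemma finite_dyadic_cubes_in_cball:
  "finite {Q \<in> dyadic_cubes n. Q \<subseteq> cball (0::'a::euclidean_space) r}" (is "finite ?S")
proof -
  define N where "N = \<lceil>2 ^ n * r\<rceil>"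
  let ?f = "\<lambda>x. {p :: 'a. \<forall>i\<in>Basis. of_int (x i) / 2 ^ n \<le> p \<bullet> i \<and> p \<bullet> i \<le> (of_int (x i) + 1) / 2 ^ n}"
  have "?S \<subseteq> ?f ` (PiE Basis (\<lambda>_. {-N..N}))"
  proof
    fix Q assume Q: "Q \<in> ?S"
    then obtain x where x: "Q = ?f x" unfolding dyadic_cubes_def by blast
    define p where "p = (\<Sum>i\<in>Basis. (of_int (x i) / 2 ^ n) *\<^sub>R i :: 'a)"
    have pi: "p \<bullet> i = of_int (x i) / 2 ^ n" if "i \<in> Basis" for i
      using that by (simp add: p_def)
    have "p \<in> Q" using x by (auto simp: pi divide_right_mono)
    then have "norm p \<le> r" using Q by auto
    have "x i \<in> {-N..N}" if "i \<in> Basis" for i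
    proof -
      have "\<bar>of_int (x i) / 2 ^ n\<bar> \<le> r"
        using Basis_le_norm[OF that, of p] pi[OF that] \<open>norm p \<le> r\<close> by simp
      then have "\<bar>real_of_int (x i)\<bar> \<le> 2 ^ n * r"
        by (simp add: abs_divide divide_simps mult.commute)
      then have "real_of_int \<bar>x i\<bar> \<le> of_int N" unfolding N_def by linarith
      then show ?thesis by (simp only: of_int_le_iff) auto
    qed
    \<comment> \<open>A cube depends only on the values of \<open>x\<close> on \<open>Basis\<close>,
      so restricting the index function leaves finitely many candidates.\<close>
    then have "restrict x Basis \<in> PiE Basis (\<lambda>_. {-N..N})" by auto
    moreover have "Q = ?f (restrict x Basis)" using x by auto
    ultimately show "Q \<in> ?f ` (PiE Basis (\<lambda>_. {-N..N}))" by blast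
  qed
  then show ?thesis
    by (rule finite_subset) (intro finite_imageI finite_PiE, auto)
qed

text \<open>Level \<open>n\<close> of a canonical name. The ball of radius \<open>n\<close> keeps
  the level finite, and its growth lets every point of an open set be reached eventually.\<close>

definition inner_cubes :: "'a::euclidean_space set \<Rightarrow> nat \<Rightarrow> 'a set set" where
  "inner_cubes U n = {Q \<in> dyadic_cubes n. Q \<subseteq> U \<and> Q \<subseteq> cball 0 (real n)}"

lemma finite_inner_cubes: "finite (inner_cubes U n)"
  unfolding inner_cubes_def
  by (rule finite_subset[OF _ finite_dyadic_cubes_in_cball[of n "real n"]]) auto

lemma closed_Union_inner_cubes: "closed (\<Union>(inner_cubes U n))"
  by (intro closed_Union finite_inner_cubes) (auto simp: inner_cubes_def intro: closed_dyadic_cube)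

text \<open>At a fine enough level, every cube meeting \<open>ball x (e / 2)\<close> lies in
  \<open>ball x e\<close>, so such cubes fill a neighbourhood of \<open>x\<close>.\<close>

lemma Union_interior_inner_cubes:
  fixes U :: "'a::euclidean_space set"
  assumes "open U"
  shows "(\<Union>n. interior (\<Union>(inner_cubes U n))) = U"
proof
  show "(\<Union>n. interior (\<Union>(inner_cubes U n))) \<subseteq> U"
    using interior_subset by (force simp: inner_cubes_def)
  show "U \<subseteq> (\<Union>n. interior (\<Union>(inner_cubes U n)))"
  proof
    fix x assume "x \<in> U"
    then obtain e where e: "0 < e" "ball x e \<subseteq> U"
      using assms open_contains_ball by blast
    have "(\<lambda>n. real DIM('a) * (1 / 2) ^ n) \<longlonglongrightarrow> real DIM('a) * 0"
      by (intro tendsto_intros LIMSEQ_power_zero) auto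
    then have "\<forall>\<^sub>F n in sequentially. real DIM('a) * (1 / 2) ^ n < e / 2"
      by (rule order_tendstoD) (use e in auto)
    then have "\<forall>\<^sub>F n in sequentially. real DIM('a) * (1 / 2) ^ n < e / 2 \<and> norm x + e \<le> real n"
      using eventually_ge_at_top[of "nat \<lceil>norm x + e\<rceil>"]
      by eventually_elim linarith
    then obtain n where n: "real DIM('a) / 2 ^ n < e / 2" "norm x + e \<le> real n"
      by (auto simp: eventually_sequentially power_one_over)
    have "ball x (e / 2) \<subseteq> \<Union>(inner_cubes U n)"
    proof
      fix y assume y: "y \<in> ball x (e / 2)"
      obtain Q where Q: "Q \<in> dyadic_cubes n" "y \<in> Q" by (rule dyadic_cubes_cover)
      have sub: "Q \<subseteq> ball x e"
      proof
        fix z assume "z \<in> Q"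
        then have "dist y z \<le> real DIM('a) / 2 ^ n"
          using dyadic_cube_subset_cball[OF Q] by auto
        then have "dist y z < e / 2" using n(1) by linarith
        then show "z \<in> ball x e"
          using y dist_triangle_half_r[of y x e z] by (auto simp: dist_commute)
      qed
      have "ball x e \<subseteq> cball 0 (real n)"
      proof
        fix z assume "z \<in> ball x e"
        then show "z \<in> cball 0 (real n)"
          using n(2) norm_triangle_sub[of z x] by (auto simp: dist_norm norm_minus_commute)
      qed
      with sub Q e(2) show "y \<in> \<Union>(inner_cubes U n)"
        unfolding inner_cubes_def by blast
    qed
    then have "x \<in> interior (\<Union>(inner_cubes U n))"
      using e(1) by (meson centre_in_ball half_gt_zero interiorI open_ball)
    then show "x \<in> (\<Union>n. interior (\<Union>(inner_cubes U n)))" by blast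
  qed
qed

lemma inner_cubes_Suc:
  assumes "Q \<in> inner_cubes U n" "Q' \<in> dyadic_cubes (Suc n)" "Q' \<subseteq> Q"
  shows "Q' \<in> inner_cubes U (Suc n)"
  using assms cball_subset_cball_iff[of "0::'a" "real n" 0 "real (Suc n)"]
  unfolding inner_cubes_def by auto

text \<open>Provides a name for every closed set, from which its neighbourhoods are built. The
  well-inside conditions hold since finite unions of closed cubes are closed.\<close>

lemma is_name_inner_cubes:
  assumes "closed A"
  shows "is_name (inner_cubes (interior A)) (inner_cubes (- A)) A"
proof -
  have "\<Union>(inner_cubes (interior B) n) \<Subset> B" for B :: "'a set" and n
    unfolding well_inside_def closure_closed[OF closed_Union_inner_cubes]
    by (auto simp: inner_cubes_def)
  from this[of A] this[of "- A"] show ?thesis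
    using assms
    unfolding is_name_def
    by (auto simp: finite_inner_cubes Union_interior_inner_cubes open_Compl interior_open
        intro: inner_cubes_Suc) (auto simp: inner_cubes_def)
qed

section \<open>Open sets of closed sets, of maps and of instances\<close>

lemma openin_prefix_nbhd:
  assumes "closed A" "is_name I E A"
  shows "openin closed_sets_topology (prefix_nbhd I E m)"
  unfolding closed_sets_topology_def
  using assms by (intro topology_generated_by_Basis) blast

text \<open>Induction with an intermediate layer: a compact neighbourhood \<open>L\<close> of the
  image of \<open>K\<close> is still mapped into \<open>U\<close>, and nearby maps send
  \<open>K\<close> in \<open>n\<close> steps into its open part \<open>V\<close>.\<close>

lemma openin_funpow_image_subset:
  fixes K U :: "'a::heine_borel set"
  assumes "compact K" "open U"
  shows "openin compact_open_topology {g. continuous_on UNIV g \<and> (g ^^ n) ` K \<subseteq> U}"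
  using assms(2)
proof (induction n arbitrary: U)
  case 0
  \<comment> \<open>For \<open>n = 0\<close> the inclusion does not involve \<open>g\<close>: the
    set is empty or consists of all continuous maps, and the latter is the subbasic set of the empty
    compact set.\<close>
  have "openin compact_open_topology {g. continuous_on UNIV g \<and> g ` {} \<subseteq> (UNIV :: 'a set)}"
    unfolding compact_open_topology_def
    by (intro topology_generated_by_Basis) blast
  then show ?case by (cases "K \<subseteq> U") auto
next
  case (Suc n)
  show ?case
  proof (subst openin_subopen, intro ballI)
    fix f assume "f \<in> {g. continuous_on UNIV g \<and> (g ^^ Suc n) ` K \<subseteq> U}"
    then have f: "continuous_on UNIV f" "(f ^^ Suc n) ` K \<subseteq> U" by auto
    have "compact ((f ^^ n) ` K)"
      using \<open>compact K\<close> f(1) by (intro compact_continuous_image continuous_on_funpow)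
    moreover have "open (f -` U)" using f(1) Suc.prems by (simp add: open_vimage)
    moreover have "(f ^^ n) ` K \<subseteq> f -` U" using f(2) by auto
    ultimately obtain e where e: "0 < e" "(\<Union>x\<in>(f ^^ n) ` K. cball x e) \<subseteq> f -` U"
      by (rule compact_subset_open_imp_cball_epsilon_subset)
    define L where "L = (\<Union>x\<in>(f ^^ n) ` K. cball x e)"
    define V where "V = (\<Union>x\<in>(f ^^ n) ` K. ball x e)"
    have "compact L"
      unfolding L_def using \<open>compact ((f ^^ n) ` K)\<close> by (rule compact_minkowski_sum_cball)
    have "V \<subseteq> L" unfolding V_def L_def by force
    have "openin compact_open_topology {g. continuous_on UNIV g \<and> g ` L \<subseteq> U}"
      unfolding compact_open_topology_def
      using \<open>compact L\<close> Suc.prems by (intro topology_generated_by_Basis) blast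
    moreover have "openin compact_open_topology {g. continuous_on UNIV g \<and> (g ^^ n) ` K \<subseteq> V}"
      by (rule Suc.IH) (auto simp: V_def)
    ultimately have "openin compact_open_topology
      ({g. continuous_on UNIV g \<and> g ` L \<subseteq> U} \<inter> {g. continuous_on UNIV g \<and> (g ^^ n) ` K \<subseteq> V})"
      (is "openin _ ?T") by (rule openin_Int)
    moreover have "f ` L \<subseteq> U" using e(2) unfolding L_def by blast
    then have "f \<in> ?T" using f e(1) unfolding V_def by auto
    moreover have "?T \<subseteq> {g. continuous_on UNIV g \<and> (g ^^ Suc n) ` K \<subseteq> U}"
    proof (clarsimp simp: image_subset_iff)
      fix g x assume "\<forall>x\<in>L. g x \<in> U" "\<forall>x\<in>K. (g ^^ n) x \<in> V" "x \<in> K"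
      then show "g ((g ^^ n) x) \<in> U" using \<open>V \<subseteq> L\<close> by blast
    qed
    ultimately show "\<exists>T. openin compact_open_topology T \<and> f \<in> T \<and>
        T \<subseteq> {g. continuous_on UNIV g \<and> (g ^^ Suc n) ` K \<subseteq> U}" by blast
  qed
qed

text \<open>For a subbasic set, the compact image of \<open>K\<close> has a uniform neighbourhood
  inside \<open>U\<close>; finite intersections take the smaller \<open>\<epsilon>\<close>.\<close>

lemma compact_open_contains_uniform_ball:
  fixes f :: "'a::topological_space \<Rightarrow> 'b::metric_space"
  assumes "openin compact_open_topology T" "f \<in> T"
  obtains \<epsilon> where "0 < \<epsilon>"
    "\<And>g. continuous_on UNIV g \<Longrightarrow> (\<And>x. dist (g x) (f x) < \<epsilon>) \<Longrightarrow> g \<in> T"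
proof -
  have "generate_topology_on {{f. continuous_on UNIV f \<and> f ` K \<subseteq> U} | K U. compact K \<and> open U} T"
    using assms(1) unfolding compact_open_topology_def
    by (rule openin_topology_generated_by)
  then have "\<exists>\<epsilon>>0. \<forall>g. continuous_on UNIV g \<longrightarrow> (\<forall>x. dist (g x) (f x) < \<epsilon>) \<longrightarrow> g \<in> T"
    using assms(2)
  proof (induction rule: generate_topology_on.induct)
    case (Int a b)
    then have "f \<in> a" "f \<in> b" by auto
    obtain e1 where e1:
      "e1 > 0" "\<forall>g. continuous_on UNIV g \<longrightarrow> (\<forall>x. dist (g x) (f x) < e1) \<longrightarrow> g \<in> a"
      using Int.IH(1)[OF \<open>f \<in> a\<close>] by blast
    obtain e2 where e2:
      "e2 > 0" "\<forall>g. continuous_on UNIV g \<longrightarrow> (\<forall>x. dist (g x) (f x) < e2) \<longrightarrow> g \<in> b"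
      using Int.IH(2)[OF \<open>f \<in> b\<close>] by blast
    show ?case using e1 e2 by (intro exI[of _ "min e1 e2"]) simp
  next
    case (UN \<K>)
    then obtain k where "k \<in> \<K>" "f \<in> k" by blast
    with UN.IH[OF this] show ?case by blast
  next
    case (Basis s)
    then obtain K U where KU: "s = {f. continuous_on UNIV f \<and> f ` K \<subseteq> U}" "compact K" "open U"
      by auto
    have "continuous_on UNIV f" "f ` K \<subseteq> U" using Basis.prems KU(1) by auto
    then have "compact (f ` K)"
      using KU(2) continuous_on_subset[of UNIV f K] by (simp add: compact_continuous_image)
    then obtain e where e: "0 < e" "(\<Union>x\<in>f ` K. ball x e) \<subseteq> U"
      using compact_subset_open_imp_ball_epsilon_subset[OF _ \<open>open U\<close> \<open>f ` K \<subseteq> U\<close>] by metis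
    have "g \<in> s" if "continuous_on UNIV g" "\<forall>x. dist (g x) (f x) < e" for g
    proof -
      have "g x \<in> U" if "x \<in> K" for x
      proof -
        have "g x \<in> ball (f x) e" using \<open>\<forall>x. dist (g x) (f x) < e\<close> by (simp add: dist_commute)
        then show ?thesis using e(2) that by blast
      qed
      then show ?thesis using that(1) KU(1) by blast
    qed
    then show ?case using e(1) by blast
  qed auto
  then show ?thesis using that by blast
qed

section \<open>Criteria for robustness\<close>

lemma compact_neighbourhood:
  fixes x :: "'a::heine_borel"
  assumes "open U" "x \<in> U"
  obtains K where "compact K" "x \<in> interior K" "K \<subseteq> U"
proof -
  obtain e where "0 < e" "cball x e \<subseteq> U" using assms open_contains_cball by blast
  moreover have "x \<in> interior (cball x e)"
    using \<open>0 < e\<close> interiorI[OF open_ball _ ball_subset_cball, of x x e] by simp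
  ultimately show ?thesis using that compact_cball by blast
qed

lemma openin_pep_topology_Times:
  assumes "openin compact_open_topology S" "openin closed_sets_topology T" "open U"
  shows "openin pep_topology ((S \<times> T \<times> U) \<inter> pep_instances)"
proof -
  have "openin euclidean U" using assms(3) by simp
  then show ?thesis
    unfolding pep_topology_def
    using assms(1,2) openin_subtopology_Int openin_prod_Times_iff by metis
qed

text \<open>The escaping iterate lies in the interior of some \<open>\<Union>(E n)\<close>. Every
  set having a name with this entry is disjoint from these cubes, and nearby maps and points still
  reach them.\<close>

lemma escapes_imp_robust:
  fixes A :: "'a::euclidean_space set"
  assumes P: "(f, A, x0) \<in> pep_instances" and "escapes (f, A, x0)"
  shows "robust (f, A, x0)"
proof -
  from P have f: "continuous_on UNIV f" and "closed A" by (auto simp: pep_instances_def)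
  obtain I E where name: "is_name I E A" using is_name_inner_cubes[OF \<open>closed A\<close>] by blast
  obtain k where "(f ^^ k) x0 \<in> - A" using assms(2) by (auto simp: escapes_def)
  then obtain n where n: "(f ^^ k) x0 \<in> interior (\<Union>(E n))"
    using name unfolding is_name_def by (metis (lifting) UN_E)
  have "open ((f ^^ k) -` interior (\<Union>(E n)))"
    using continuous_on_funpow[OF f] by (simp add: open_vimage)
  with n obtain K where K: "compact K" "x0 \<in> interior K" "K \<subseteq> (f ^^ k) -` interior (\<Union>(E n))"
    by (metis compact_neighbourhood vimageI)
  \<comment> \<open>The prefix of length \<open>Suc n\<close> includes the entry with index
    \<open>n\<close>.\<close>
  define V where "V = ({g. continuous_on UNIV g \<and> (g ^^ k) ` K \<subseteq> interior (\<Union>(E n))} \<times>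
      prefix_nbhd I E (Suc n) \<times> interior K) \<inter> pep_instances"
  have "openin pep_topology V"
    unfolding V_def using K(1) name \<open>closed A\<close>
    by (intro openin_pep_topology_Times openin_funpow_image_subset openin_prefix_nbhd) auto
  moreover have "(f, A, x0) \<in> V"
    using P f K \<open>closed A\<close> name unfolding V_def prefix_nbhd_def by auto
  moreover have "escapes Q" if "Q \<in> V" for Q
  proof -
    obtain g B x where Q: "Q = (g, B, x)" by (cases Q)
    with that have gx: "(g ^^ k) x \<in> interior (\<Union>(E n))" and B: "B \<in> prefix_nbhd I E (Suc n)"
      unfolding V_def using interior_subset by blast+
    from B obtain I' E' where "is_name I' E' B" "E' n = E n"
      unfolding prefix_nbhd_def by auto
    then have "closure (\<Union>(E n)) \<subseteq> interior (- B)"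
      unfolding is_name_def well_inside_def by metis
    with gx have "(g ^^ k) x \<notin> B"
      using interior_subset closure_subset by blast
    then show ?thesis unfolding Q escapes_def by auto
  qed
  ultimately show ?thesis using assms(2) unfolding robust_def by blast
qed

text \<open>Finitely many conditions control the infinite orbit: the first \<open>j\<close> steps of
  the point, its arrival in \<open>D\<close>, the first \<open>n\<close> images of \<open>D\<close>,
  and the return of \<open>D\<close> into itself. The compact sets that must stay in
  \<open>A\<close> are certified by finitely many entries of a name.\<close>

lemma trapping_region_imp_robust:
  fixes A :: "'a::euclidean_space set"
  assumes P: "(f, A, x0) \<in> pep_instances"
    and "compact D" "n \<ge> 1" "(f ^^ n) ` D \<subseteq> interior D"
    and DA: "\<And>i. (f ^^ i) ` D \<subseteq> interior A"
    and xA: "\<And>i. (f ^^ i) x0 \<in> interior A" and "(f ^^ j) x0 \<in> interior D"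
  shows "robust (f, A, x0) \<and> trapped (f, A, x0)"
proof -
  from P have f: "continuous_on UNIV f" and "closed A" by (auto simp: pep_instances_def)
  obtain I E where name: "is_name I E A" using is_name_inner_cubes[OF \<open>closed A\<close>] by blast
  define L where "L = (\<Union>i<n. (f ^^ i) ` D) \<union> (\<lambda>i. (f ^^ i) x0) ` {..<j}"
  have "compact L"
    unfolding L_def using \<open>compact D\<close> f
    by (intro compact_Un compact_UN compact_continuous_image[OF continuous_on_funpow]
        finite_imp_compact[OF finite_imageI]) auto
  moreover have "L \<subseteq> (\<Union>n. interior (\<Union>(I n)))"
  proof -
    have "L \<subseteq> interior A" using DA xA unfolding L_def by auto
    then show ?thesis using name unfolding is_name_def by simp
  qed
  ultimately obtain N where N: "finite N" "L \<subseteq> (\<Union>n\<in>N. interior (\<Union>(I n)))"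
    using compactE_image[of L UNIV "\<lambda>n. interior (\<Union>(I n))"] by auto
  define O' where "O' = (\<Union>n\<in>N. interior (\<Union>(I n)))"
  have "open O'" unfolding O'_def by auto
  \<comment> \<open>A prefix of length \<open>m\<close> contains every \<open>I k\<close> that
    occurs in \<open>O'\<close>.\<close>
  obtain m where m: "\<forall>k\<in>N. k < m" using N(1) finite_nat_set_iff_bounded by blast
  have "open ((\<Inter>i<j. (f ^^ i) -` O') \<inter> (f ^^ j) -` interior D)"
    using continuous_on_funpow[OF f] \<open>open O'\<close> by (intro open_Int open_INT) (auto simp: open_vimage)
  moreover have "x0 \<in> (\<Inter>i<j. (f ^^ i) -` O') \<inter> (f ^^ j) -` interior D"
    using N(2) assms(7) unfolding L_def O'_def by auto
  ultimately obtain K where K: "compact K" "x0 \<in> interior K"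
      "K \<subseteq> (\<Inter>i<j. (f ^^ i) -` O') \<inter> (f ^^ j) -` interior D"
    by (rule compact_neighbourhood)
  \<comment> \<open>The case distinction joins the first \<open>j\<close> steps and the arrival in
    \<open>interior D\<close> under the index set \<open>{..<Suc j}\<close>, which is nonempty even
    for \<open>j = 0\<close>.\<close>
  define S where "S = (\<Inter>i<n. {g. continuous_on UNIV g \<and> (g ^^ i) ` D \<subseteq> O'}) \<inter>
    {g. continuous_on UNIV g \<and> (g ^^ n) ` D \<subseteq> interior D} \<inter>
    ((\<Inter>i\<in>{..<Suc j}. {g. continuous_on UNIV g \<and> (g ^^ i) ` K \<subseteq> (if i < j then O' else interior D)}))"
  have "openin compact_open_topology S"
    unfolding S_def using \<open>compact D\<close> \<open>open O'\<close> K(1) \<open>n \<ge> 1\<close>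
    by (intro openin_Int openin_INT2 openin_funpow_image_subset) (auto simp: lessThan_empty_iff)
  define V where "V = (S \<times> prefix_nbhd I E m \<times> interior K) \<inter> pep_instances"
  have "openin pep_topology V"
    unfolding V_def using \<open>openin compact_open_topology S\<close> name \<open>closed A\<close>
    by (intro openin_pep_topology_Times openin_prefix_nbhd) auto
  moreover have "f \<in> S"
  proof -
    have "(f ^^ i) ` D \<subseteq> O'" if "i < n" for i
      using N(2) that unfolding L_def O'_def[symmetric] by blast
    moreover have "(f ^^ i) ` K \<subseteq> (if i < j then O' else interior D)" if "i < Suc j" for i
    proof (cases "i < j")
      case True
      then show ?thesis using K(3) by auto
    next
      case False
      then have "i = j" using that by simp
      then show ?thesis using K(3) by auto
    qed
    ultimately show ?thesis unfolding S_def using f assms(4) by blast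
  qed
  then have "(f, A, x0) \<in> V"
    using P K \<open>closed A\<close> name unfolding V_def prefix_nbhd_def by auto
  moreover have tr: "trapped Q" if "Q \<in> V" for Q
  proof -
    obtain g B x where Q: "Q = (g, B, x)" by (cases Q)
    with that have "g \<in> S" and B: "B \<in> prefix_nbhd I E m" and "x \<in> K"
      unfolding V_def using interior_subset by blast+
    from B obtain I' E' where "is_name I' E' B" "\<forall>k<m. I' k = I k"
      unfolding prefix_nbhd_def by auto
    then have "closure (\<Union>(I k)) \<subseteq> interior B" if "k < m" for k
      using that unfolding is_name_def well_inside_def by metis
    then have "interior (\<Union>(I k)) \<subseteq> B" if "k < m" for k
      using that interior_subset[of B] interior_subset[of "\<Union>(I k)"] closure_subset[of "\<Union>(I k)"]
      by fastforce
    then have OB: "O' \<subseteq> B" unfolding O'_def using m by blast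
    have S: "\<forall>i<n. (g ^^ i) ` D \<subseteq> O'" "(g ^^ n) ` D \<subseteq> interior D"
      "\<forall>i<Suc j. (g ^^ i) ` K \<subseteq> (if i < j then O' else interior D)"
      using \<open>g \<in> S\<close> unfolding S_def by simp_all
    have gD: "(g ^^ i) y \<in> B" if "y \<in> D" "i < n" for i y
      using S(1) that OB by blast
    have gn: "(g ^^ n) y \<in> D" if "y \<in> D" for y
      using S(2) that interior_subset[of D] by blast
    have gDall: "(g ^^ i) y \<in> B" if "y \<in> D" for i y
    proof -
      have "((g ^^ n) ^^ (i div n)) y \<in> D" using gn that by (rule funpow_in_invariant)
      then have "(g ^^ (i mod n)) ((g ^^ (n * (i div n))) y) \<in> B"
        using \<open>n \<ge> 1\<close> by (intro gD) (auto simp: funpow_mult mult.commute)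
      moreover have "(g ^^ (i mod n)) ((g ^^ (n * (i div n))) y) = (g ^^ i) y"
        using funpow_add[of "i mod n" "n * (i div n)" g] by simp
      ultimately show ?thesis by simp
    qed
    have gK: "(g ^^ i) x \<in> (if i < j then O' else interior D)" if "i < Suc j" for i
      using S(3) \<open>x \<in> K\<close> that by blast
    have "(g ^^ i) x \<in> B" for i
    proof (cases "i < j")
      case True
      then show ?thesis using gK[of i] OB by auto
    next
      case False
      have "(g ^^ j) x \<in> D" using gK[of j] interior_subset[of D] by auto
      then have "(g ^^ (i - j)) ((g ^^ j) x) \<in> B" by (rule gDall)
      moreover have "(g ^^ (i - j)) ((g ^^ j) x) = (g ^^ i) x"
        using False funpow_add[of "i - j" j g] by simp
      ultimately show ?thesis by simp
    qed
    then show ?thesis unfolding Q trapped_def escapes_def by simp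
  qed
  ultimately show ?thesis unfolding robust_def trapped_def by metis
qed

text \<open>Set and point are kept fixed: a product box inside the robust neighbourhood has a first
  factor containing a uniform ball of maps.\<close>

lemma robust_trapped_uniform:
  assumes P: "(f, A, x0) \<in> pep_instances" and "robust (f, A, x0)" "trapped (f, A, x0)"
  obtains \<epsilon> where "0 < \<epsilon>"
    "\<And>g. continuous_on UNIV g \<Longrightarrow> (\<And>x. dist (g x) (f x) < \<epsilon>) \<Longrightarrow> trapped (g, A, x0)"
proof -
  obtain V where V: "openin pep_topology V" "(f, A, x0) \<in> V" "\<And>Q. Q \<in> V \<Longrightarrow> trapped Q"
    using assms(2,3) unfolding robust_def trapped_def by blast
  obtain T where T: "openin (prod_topology compact_open_topology (prod_topology closed_sets_topology euclidean)) T"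
    "V = T \<inter> pep_instances"
    using V(1) unfolding pep_topology_def openin_subtopology by blast
  have "(f, (A, x0)) \<in> T" using V(2) T(2) by simp
  then obtain S S' where S: "openin compact_open_topology S" "f \<in> S" "(A, x0) \<in> S'" "S \<times> S' \<subseteq> T"
    using T(1)[unfolded openin_prod_topology_alt, rule_format] by metis
  obtain \<epsilon> where \<epsilon>: "0 < \<epsilon>" "\<And>g. continuous_on UNIV g \<Longrightarrow> (\<And>x. dist (g x) (f x) < \<epsilon>) \<Longrightarrow> g \<in> S"
    using compact_open_contains_uniform_ball[OF S(1,2)] by blast
  have "trapped (g, A, x0)" if "continuous_on UNIV g" "\<And>x. dist (g x) (f x) < \<epsilon>" for g
  proof (rule V(3))
    have "(g, (A, x0)) \<in> S \<times> S'" using \<epsilon>(2)[OF that] S(3) by simp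
    then show "(g, A, x0) \<in> V"
      using that(1) S(4) P unfolding T(2) pep_instances_def by blast
  qed
  with \<epsilon>(1) show ?thesis using that by blast
qed

subsection \<open>Hyperbolicity along a component\<close>

text \<open>Vitali's theorem. All subsequential limits agree on \<open>N\<close>, hence on
  \<open>S\<close> by analytic continuation, so the full sequence converges.\<close>

lemma Montel_pointwise_limit:
  fixes \<phi> :: "nat \<Rightarrow> complex \<Rightarrow> complex"
  assumes S: "open S" "connected S" and hol: "\<And>k. \<phi> k holomorphic_on S"
    and bound: "\<And>k z. z \<in> S \<Longrightarrow> norm (\<phi> k z) \<le> B"
    and N: "open N" "N \<subseteq> S" "N \<noteq> {}" and lim: "\<And>z. z \<in> N \<Longrightarrow> (\<lambda>k. \<phi> k z) \<longlonglongrightarrow> p z"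
  obtains w where "w holomorphic_on S" "\<And>z. z \<in> S \<Longrightarrow> (\<lambda>k. \<phi> k z) \<longlonglongrightarrow> w z"
proof -
  define \<H> where "\<H> = {h. h holomorphic_on S \<and> (\<forall>z\<in>S. norm (h z) \<le> B)}"
  have montel: "\<exists>g r. g holomorphic_on S \<and> strict_mono (r :: nat \<Rightarrow> nat) \<and>
      (\<forall>z\<in>S. (\<lambda>k. \<phi> (s (r k)) z) \<longlonglongrightarrow> g z)" for s :: "nat \<Rightarrow> nat"
  proof -
    have rng: "range (\<lambda>k. \<phi> (s k)) \<subseteq> \<H>" using hol bound unfolding \<H>_def by auto
    have "\<exists>b. \<forall>h\<in>\<H>. \<forall>z\<in>K. norm (h z) \<le> b" if "K \<subseteq> S" for K
      using that unfolding \<H>_def by blast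
    moreover have "h holomorphic_on S" if "h \<in> \<H>" for h using that unfolding \<H>_def by blast
    ultimately obtain g r where "g holomorphic_on S" "strict_mono (r :: nat \<Rightarrow> nat)"
        "\<And>z. z \<in> S \<Longrightarrow> (\<lambda>k. \<phi> (s (r k)) z) \<longlonglongrightarrow> g z"
      using Montel[OF S(1) _ _ rng] by metis
    then show ?thesis by blast
  qed
  obtain w r0 where w: "w holomorphic_on S" "strict_mono (r0 :: nat \<Rightarrow> nat)"
      "\<And>z. z \<in> S \<Longrightarrow> (\<lambda>k. \<phi> (r0 k) z) \<longlonglongrightarrow> w z"
    using montel[of "\<lambda>k. k"] by blast
  have wN: "w z = p z" if "z \<in> N" for z
  proof -
    have "(\<lambda>k. \<phi> (r0 k) z) \<longlonglongrightarrow> p z"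
      using LIMSEQ_subseq_LIMSEQ[OF lim[OF that] w(2)] by (simp add: o_def)
    moreover have "z \<in> S" using that N(2) by blast
    ultimately show ?thesis using w(3) LIMSEQ_unique by blast
  qed
  obtain z0 where "z0 \<in> N" using N(3) by blast
  have "(\<lambda>k. \<phi> k z) \<longlonglongrightarrow> w z" if "z \<in> S" for z
  proof (rule ccontr)
    assume "\<not> (\<lambda>k. \<phi> k z) \<longlonglongrightarrow> w z"
    then obtain e where "0 < e" and "\<not> (\<forall>\<^sub>F k in sequentially. dist (\<phi> k z) (w z) < e)"
      unfolding tendsto_iff by blast
    then have inf: "infinite {k. e \<le> dist (\<phi> k z) (w z)}"
      unfolding cofinite_eq_sequentially[symmetric] eventually_cofinite by (simp add: not_less)
    \<comment> \<open>\<open>s\<close> lists the indices whose values at \<open>z\<close> stay away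
      from \<open>w z\<close>; a convergent subsequence of these gives the contradiction.\<close>
    define s where "s = enumerate {k. e \<le> dist (\<phi> k z) (w z)}"
    have s: "strict_mono s" "\<And>k. e \<le> dist (\<phi> (s k) z) (w z)"
      unfolding s_def using inf strict_mono_enumerate enumerate_in_set by auto
    obtain g r where g: "g holomorphic_on S" "strict_mono (r :: nat \<Rightarrow> nat)"
        "\<And>z. z \<in> S \<Longrightarrow> (\<lambda>k. \<phi> (s (r k)) z) \<longlonglongrightarrow> g z"
      using montel[of s] by blast
    have "g y = w y" if "y \<in> N" for y
    proof -
      have "(\<lambda>k. \<phi> (s (r k)) y) \<longlonglongrightarrow> p y"
        using LIMSEQ_subseq_LIMSEQ[OF lim[OF that] strict_mono_o[OF s(1) g(2)]] by (simp add: o_def)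
      moreover have "y \<in> S" using that N(2) by blast
      ultimately show ?thesis using g(3) LIMSEQ_unique wN[OF that] by metis
    qed
    then have "g z - w z = 0"
      using analytic_continuation_open[OF N(1) S(1) N(3) S(2) N(2) g(1) w(1)] that by simp
    then have "(\<lambda>k. \<phi> (s (r k)) z) \<longlonglongrightarrow> w z" using g(3)[OF that] by simp
    then have "\<forall>\<^sub>F k in sequentially. dist (\<phi> (s (r k)) z) (w z) < e"
      using \<open>0 < e\<close> by (rule tendstoD)
    then obtain k where "dist (\<phi> (s (r k)) z) (w z) < e" by (auto simp: eventually_sequentially)
    then show False using s(2)[of "r k"] by simp
  qed
  with w(1) show ?thesis using that by blast
qed

text \<open>Each return multiplies the distance to \<open>p\<close> by \<open>norm (q k)\<close>,
  which eventually exceeds 1. A distance that no longer decreases yet tends to 0 is already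
  0.\<close>

lemma tendsto_repelling_imp_eventually_eq:
  assumes fp: "(quad c ^^ n) p = p" and "1 < norm (deriv (quad c ^^ n) p)"
    and lim: "(\<lambda>k. ((quad c ^^ n) ^^ k) x) \<longlonglongrightarrow> p"
  obtains k where "((quad c ^^ n) ^^ k) x = p"
proof -
  define \<phi> where "\<phi> = (\<lambda>k. ((quad c ^^ n) ^^ k) x)"
  define q where "q = (\<lambda>k. \<Prod>i<n. (quad c ^^ i) (\<phi> k) + (quad c ^^ i) p)"
  have step: "\<phi> (Suc k) - p = (\<phi> k - p) * q k" for k
    using quad_funpow_diff[of n c "\<phi> k" p] fp by (simp add: \<phi>_def q_def)
  have "q \<longlonglongrightarrow> (\<Prod>i<n. (quad c ^^ i) p + (quad c ^^ i) p)"
    unfolding q_def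
  proof (intro tendsto_prod tendsto_add tendsto_const)
    fix i
    have "isCont (quad c ^^ i) p"
      using continuous_on_funpow[OF continuous_on_quad, of UNIV i] by (simp add: continuous_on_eq_continuous_at)
    then show "(\<lambda>k. (quad c ^^ i) (\<phi> k)) \<longlonglongrightarrow> (quad c ^^ i) p"
      using lim unfolding \<phi>_def by (rule isCont_tendsto_compose)
  qed
  then have "(\<lambda>k. norm (q k)) \<longlonglongrightarrow> norm (deriv (quad c ^^ n) p)"
    unfolding deriv_quad_funpow mult_2 by (rule tendsto_norm)
  then have "\<forall>\<^sub>F k in sequentially. 1 < norm (q k)"
    using assms(2) by (rule order_tendstoD)
  then obtain K where K: "\<And>k. k \<ge> K \<Longrightarrow> 1 < norm (q k)"
    unfolding eventually_sequentially by blast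
  have mono: "norm (\<phi> K - p) \<le> norm (\<phi> (K + k) - p)" for k
  proof (induction k)
    case (Suc k)
    have "norm (\<phi> (K + k) - p) * 1 \<le> norm (\<phi> (K + k) - p) * norm (q (K + k))"
      using K[of "K + k"] by (intro mult_left_mono) auto
    then show ?case using Suc step[of "K + k"] by (simp add: norm_mult)
  qed simp
  have "(\<lambda>k. norm (\<phi> (K + k) - p)) \<longlonglongrightarrow> norm (p - p)"
    using LIMSEQ_ignore_initial_segment[OF lim, of K] unfolding \<phi>_def
    by (intro tendsto_intros) (simp add: add.commute)
  then have "norm (\<phi> K - p) \<le> norm (p - p)"
    by (rule LIMSEQ_le_const) (use mono in blast)
  then have "((quad c ^^ n) ^^ K) x = p" by (simp add: \<phi>_def)
  then show ?thesis using that by blast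
qed

text \<open>The periodic point is continued as the limit \<open>w\<close> of the samples
  \<open>\<phi> k\<close>. These are holomorphic in \<open>c\<close> and bounded by 2 on
  \<open>H\<close>, so convergence near \<open>c0\<close> extends to all of
  \<open>H\<close>.\<close>

lemma attracting_cycle_persists_on_component:
  assumes H: "open H" "connected H" "H \<subseteq> mandelbrot"
    and "c0 \<in> H" "has_attracting_cycle (quad c0)" and "c1 \<in> H"
  shows "has_attracting_cycle (quad c1)"
proof -
  have "c0 \<in> mandelbrot" using assms by blast
  then obtain z r n j where n: "n \<ge> 1" and r: "0 < r" "(quad c0 ^^ n) ` cball z r \<subseteq> ball z r"
    "(quad c0 ^^ j) 0 \<in> ball z r"
    using attracting_cycle_imp_trapping_disc[OF _ assms(5)] by metis
  define T where "T = {g. continuous_on UNIV g \<and> (g ^^ n) ` cball z r \<subseteq> ball z r} \<inter>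
      {g. continuous_on UNIV g \<and> (g ^^ j) ` {0} \<subseteq> ball z r}"
  have "openin compact_open_topology T"
    unfolding T_def by (intro openin_Int openin_funpow_image_subset) auto
  moreover have "quad c0 \<in> T" using r continuous_on_quad unfolding T_def by auto
  ultimately obtain e where e: "0 < e"
    "\<And>g. continuous_on UNIV g \<Longrightarrow> (\<And>x. dist (g x) (quad c0 x) < e) \<Longrightarrow> g \<in> T"
    using compact_open_contains_uniform_ball by blast
  \<comment> \<open>\<open>quad c\<close> and \<open>quad c0\<close> differ by the constant
    \<open>c - c0\<close>, so the uniform ball of maps becomes a disc of parameters sharing the same
    trapping disc.\<close>
  define N where "N = ball c0 e \<inter> H"
  have N: "open N" "N \<subseteq> H" "c0 \<in> N"
    unfolding N_def using H(1) e(1) assms(4) by auto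
  define \<phi> where "\<phi> = (\<lambda>k c. ((quad c ^^ n) ^^ k) ((quad c ^^ j) 0))"
  have \<phi>_eq: "\<phi> k c = (quad c ^^ (n * k + j)) 0" for k c
    unfolding \<phi>_def by (simp add: funpow_add funpow_mult mult.commute)
  have loc: "\<exists>p. (quad c ^^ n) p = p \<and> norm (deriv (quad c ^^ n) p) < 1 \<and> (\<lambda>k. \<phi> k c) \<longlonglongrightarrow> p"
    if "c \<in> N" for c
  proof -
    have "quad c \<in> T"
      using that unfolding N_def
      by (intro e(2) continuous_on_quad) (auto simp: quad_def dist_norm norm_minus_commute)
    then have T: "(quad c ^^ n) ` cball z r \<subseteq> ball z r" "(quad c ^^ j) 0 \<in> ball z r"
      unfolding T_def by auto
    have "compact ((quad c ^^ n) ` cball z r)"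
      by (intro compact_continuous_image continuous_on_funpow continuous_on_quad compact_cball)
    then obtain \<epsilon> where \<epsilon>: "0 < \<epsilon>" "(\<Union>x\<in>(quad c ^^ n) ` cball z r. ball x \<epsilon>) \<subseteq> ball z r"
      using compact_subset_open_imp_ball_epsilon_subset[OF _ open_ball T(1)] by blast
    obtain p where p: "(quad c ^^ n) p = p" "norm (deriv (quad c ^^ n) p) < 1"
      "\<And>x. x \<in> ball z r \<Longrightarrow> (\<lambda>k. ((quad c ^^ n) ^^ k) x) \<longlonglongrightarrow> p"
    proof (rule strictly_inside_imp_attracting_fixpoint[of "ball z r" "quad c ^^ n" \<epsilon>])
      show "ball ((quad c ^^ n) x) \<epsilon> \<subseteq> ball z r" if "x \<in> ball z r" for x
        using \<epsilon>(2) that ball_subset_cball by blast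
    qed (use r(1) \<epsilon>(1) holomorphic_on_quad_iterate in auto)
    then show ?thesis using T(2) unfolding \<phi>_def by blast
  qed
  then obtain p where p: "\<And>c. c \<in> N \<Longrightarrow> (quad c ^^ n) (p c) = p c"
      "\<And>c. c \<in> N \<Longrightarrow> norm (deriv (quad c ^^ n) (p c)) < 1" "\<And>c. c \<in> N \<Longrightarrow> (\<lambda>k. \<phi> k c) \<longlonglongrightarrow> p c"
    by metis
  have \<phi>_hol: "\<phi> k holomorphic_on H" for k
    unfolding \<phi>_eq by (intro holomorphic_on_quad_funpow holomorphic_intros)
  have \<phi>_bound: "norm (\<phi> k c) \<le> 2" if "c \<in> H" for k c
    using mandelbrot_orbit_norm_le that H(3) unfolding \<phi>_eq by blast
  have "N \<noteq> {}" using N(3) by blast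
  obtain w where w: "w holomorphic_on H" "\<And>c. c \<in> H \<Longrightarrow> (\<lambda>k. \<phi> k c) \<longlonglongrightarrow> w c"
    using Montel_pointwise_limit[OF H(1,2) \<phi>_hol \<phi>_bound N(1,2) \<open>N \<noteq> {}\<close> p(3)] by blast
  have wfix: "(quad c ^^ n) (w c) = w c" if "c \<in> H" for c
  proof (rule LIMSEQ_unique)
    show "(\<lambda>k. \<phi> (Suc k) c) \<longlonglongrightarrow> w c" using w(2)[OF that] by (rule LIMSEQ_Suc)
    have "isCont (quad c ^^ n) (w c)"
      using continuous_on_funpow[OF continuous_on_quad, of UNIV n] by (simp add: continuous_on_eq_continuous_at)
    from isCont_tendsto_compose[OF this w(2)[OF that]]
    show "(\<lambda>k. \<phi> (Suc k) c) \<longlonglongrightarrow> (quad c ^^ n) (w c)" by (simp add: \<phi>_def)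
  qed
  define m where "m = (\<lambda>c. deriv (quad c ^^ n) (w c))"
  have "m holomorphic_on H"
    unfolding m_def deriv_quad_funpow
    by (intro holomorphic_intros holomorphic_on_quad_funpow w(1))
  have not_repelling: "norm (m c) \<le> 1" if "c \<in> H" for c
  proof (rule ccontr)
    assume "\<not> norm (m c) \<le> 1"
    \<comment> \<open>Repulsion would hold on the nonempty open set \<open>V\<close>. There the
      critical orbit lands exactly on \<open>w d\<close>, a relation satisfied by only countably
      many parameters.\<close>
    define V where "V = H \<inter> (\<lambda>c. norm (m c)) -` {1<..}"
    have "open V"
      unfolding V_def using \<open>m holomorphic_on H\<close> H(1)
      by (intro continuous_open_preimage continuous_on_norm holomorphic_on_imp_continuous_on) auto
    have "V \<noteq> {}" using \<open>\<not> norm (m c) \<le> 1\<close> that unfolding V_def by auto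
    have "V \<subseteq> (\<Union>k. {c. (quad c ^^ (n * k + j)) 0 = (quad c ^^ (n * Suc k + j)) 0})"
    proof
      fix d assume "d \<in> V"
      then have "d \<in> H" "1 < norm (deriv (quad d ^^ n) (w d))" unfolding V_def m_def by auto
      then obtain k where k: "\<phi> k d = w d"
        using tendsto_repelling_imp_eventually_eq[OF wfix] w(2) unfolding \<phi>_def by metis
      have "\<phi> (Suc k) d = \<phi> k d" using wfix[OF \<open>d \<in> H\<close>] k by (simp add: \<phi>_def)
      then show "d \<in> (\<Union>k. {c. (quad c ^^ (n * k + j)) 0 = (quad c ^^ (n * Suc k + j)) 0})"
        unfolding \<phi>_eq by (intro UN_I[of k]) simp_all
    qed
    moreover have "countable (\<Union>k. {c. (quad c ^^ (n * k + j)) 0 = (quad c ^^ (n * Suc k + j)) 0})"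
      using n by (intro countable_UN countable_critical_relation) auto
    ultimately have "countable V" using countable_subset by blast
    moreover obtain d e where "0 < e" "ball d e \<subseteq> V"
      using \<open>open V\<close> \<open>V \<noteq> {}\<close> open_contains_ball by blast
    ultimately show False using uncountable_ball countable_subset by blast
  qed
  have "norm (m c1) < 1"
  proof (rule ccontr)
    \<comment> \<open>Then \<open>norm (m c)\<close> is maximal at \<open>c1\<close>, so
      \<open>m\<close> is constant, although its modulus at \<open>c0\<close> is less than
      1.\<close>
    assume "\<not> norm (m c1) < 1"
    then have "norm (m c) \<le> norm (m c1)" if "c \<in> H" for c
      using not_repelling[OF that] by linarith
    then have "m constant_on H"
      by (rule maximum_modulus_principle[OF \<open>m holomorphic_on H\<close> H(1,2) H(1) order_refl \<open>c1 \<in> H\<close>])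
    then have "m c1 = m c0" using \<open>c0 \<in> H\<close> \<open>c1 \<in> H\<close> unfolding constant_on_def by metis
    moreover have "w c0 = p c0"
      using w(2)[OF \<open>c0 \<in> H\<close>] p(3)[OF N(3)] LIMSEQ_unique by blast
    ultimately show False using p(2)[OF N(3)] \<open>\<not> norm (m c1) < 1\<close> by (simp add: m_def)
  qed
  then show ?thesis
    using has_attracting_cycleI[OF holomorphic_on_quad_iterate[of 1, simplified] n wfix[OF \<open>c1 \<in> H\<close>]]
    unfolding m_def by simp
qed

subsection \<open>The reduction\<close>

text \<open>An isometry for the Euclidean distance on pairs, conjugating \<open>quad c\<close> to
  \<open>real_quad c\<close>.\<close>

definition complex_pair :: "complex \<Rightarrow> real \<times> real" where
  "complex_pair z = (Re z, Im z)"

lemma dist_complex_pair [simp]: "dist (complex_pair z) (complex_pair w) = dist z w"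
  by (simp add: complex_pair_def dist_Pair_Pair dist_real_def dist_norm[of z] cmod_def)

lemma norm_complex_pair [simp]: "norm (complex_pair z) = norm z"
  by (simp add: complex_pair_def norm_Pair cmod_def)

lemma complex_pair_Complex [simp]: "complex_pair (Complex x y) = (x, y)"
  by (simp add: complex_pair_def)

lemma range_complex_pair: "range complex_pair = UNIV"
  using complex_pair_Complex by (metis surj_def surj_pair)

lemma complex_pair_image_ball: "complex_pair ` ball z r = ball (complex_pair z) r"
  and complex_pair_image_cball: "complex_pair ` cball z r = cball (complex_pair z) r"
proof -
  have *: "p \<in> complex_pair ` {w. P (dist z w)} \<longleftrightarrow> P (dist (complex_pair z) p)" for P p
  proof -
    obtain w where "p = complex_pair w" using range_complex_pair by blast
    moreover have "inj complex_pair" by (auto simp: inj_def complex_pair_def complex_eq_iff)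
    ultimately show ?thesis by (simp add: inj_image_mem_iff)
  qed
  show "complex_pair ` ball z r = ball (complex_pair z) r"
    using *[of _ "\<lambda>d. d < r"] unfolding ball_def by auto
  show "complex_pair ` cball z r = cball (complex_pair z) r"
    using *[of _ "\<lambda>d. d \<le> r"] unfolding cball_def by auto
qed

lemma funpow_complex_pair_conj:
  assumes "\<And>z. G (complex_pair z) = complex_pair (g z)"
  shows "(G ^^ k) (complex_pair z) = complex_pair ((g ^^ k) z)"
  by (induction k) (simp_all add: assms)

lemma real_quad_complex_pair: "real_quad c (complex_pair z) = complex_pair (quad c z)"
  by (simp add: real_quad_def complex_pair_def quad_def power2_eq_square algebra_simps)

lemma real_quad_funpow_complex_pair:
  "(real_quad c ^^ k) (complex_pair z) = complex_pair ((quad c ^^ k) z)"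
  by (rule funpow_complex_pair_conj) (rule real_quad_complex_pair)

lemma real_quad_funpow_zero: "(real_quad c ^^ k) 0 = complex_pair ((quad c ^^ k) 0)"
  using real_quad_funpow_complex_pair[of k c 0]
  by (simp add: complex_pair_def zero_prod_def)

lemma mandelbrot_instance_in_pep_instances: "mandelbrot_instance c \<in> pep_instances"
proof -
  have "continuous_on UNIV (real_quad c)"
    unfolding real_quad_def case_prod_beta by (intro continuous_intros)
  moreover have "closed {z :: real \<times> real. infnorm z \<le> 3}"
    by (intro closed_Collect_le continuous_on_const continuous_at_imp_continuous_on ballI
        continuous_infnorm continuous_ident)
  ultimately show ?thesis
    by (simp add: mandelbrot_instance_def pep_instances_def infnorm_0)
qed

text \<open>The supremum norm is at most the Euclidean one; the gap between 2 and 3 supplies the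
  room that robustness requires.\<close>

lemma norm_le_2_imp_interior:
  assumes "norm (p :: real \<times> real) \<le> 2"
  shows "p \<in> interior {z. infnorm z \<le> 3}"
proof (rule interiorI)
  show "ball 0 3 \<subseteq> {z :: real \<times> real. infnorm z \<le> 3}"
  proof
    fix z :: "real \<times> real" assume "z \<in> ball 0 3"
    then show "z \<in> {z. infnorm z \<le> 3}" using infnorm_le_norm[of z] by simp
  qed
qed (use assms in auto)

lemma norm_le_infnorm_complex_pair:
  assumes "infnorm (complex_pair z) \<le> r"
  shows "norm z \<le> sqrt DIM(real \<times> real) * r"
proof -
  have "norm z \<le> sqrt DIM(real \<times> real) * infnorm (complex_pair z)"
    using norm_le_infnorm[of "complex_pair z"] by (simp only: norm_complex_pair)
  also have "\<dots> \<le> sqrt DIM(real \<times> real) * r"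
    using assms by (intro mult_left_mono) auto
  finally show ?thesis .
qed

lemma bounded_infnorm_complex_pair: "bounded {z. infnorm (complex_pair z) \<le> r}"
  unfolding bounded_iff using norm_le_infnorm_complex_pair by blast

lemma mandelbrot_iff_trapped: "c \<in> mandelbrot \<longleftrightarrow> trapped (mandelbrot_instance c)"
proof
  assume "c \<in> mandelbrot"
  then have "(real_quad c ^^ k) 0 \<in> interior {z. infnorm z \<le> 3}" for k
    using mandelbrot_orbit_norm_le by (intro norm_le_2_imp_interior) (simp add: real_quad_funpow_zero)
  then show "trapped (mandelbrot_instance c)"
    unfolding trapped_def escapes_def mandelbrot_instance_def
    using interior_subset[of "{z. infnorm z \<le> 3}"] by simp blast
next
  assume "trapped (mandelbrot_instance c)"
  then have "range (\<lambda>k. (quad c ^^ k) 0) \<subseteq> {z. infnorm (complex_pair z) \<le> 3}"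
    by (auto simp: trapped_def escapes_def mandelbrot_instance_def real_quad_funpow_zero)
  then show "c \<in> mandelbrot"
    unfolding mandelbrot_def using bounded_infnorm_complex_pair bounded_subset by blast
qed

lemma attracting_cycle_imp_robust:
  assumes c: "c \<in> mandelbrot" and att: "has_attracting_cycle (quad c)"
  shows "robust (mandelbrot_instance c)"
proof -
  obtain z r n j where n: "n \<ge> 1" and r: "0 < r" "(quad c ^^ n) ` cball z r \<subseteq> ball z r"
    "(quad c ^^ j) 0 \<in> ball z r" "\<And>w i. w \<in> cball z r \<Longrightarrow> norm ((quad c ^^ i) w) \<le> 2"
    using attracting_cycle_imp_trapping_disc[OF c att] by metis
  have conj: "(real_quad c ^^ i) ` complex_pair ` S = complex_pair ` (quad c ^^ i) ` S" for i S
    by (simp add: image_image real_quad_funpow_complex_pair)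
  have ball: "complex_pair ` ball z r \<subseteq> interior (complex_pair ` cball z r)"
    unfolding complex_pair_image_ball complex_pair_image_cball
    by (intro interior_maximal) auto
  have "robust (real_quad c, {z. infnorm z \<le> 3}, 0) \<and> trapped (real_quad c, {z. infnorm z \<le> 3}, 0)"
  proof (rule trapping_region_imp_robust)
    show "(real_quad c, {z. infnorm z \<le> 3}, 0) \<in> pep_instances"
      using mandelbrot_instance_in_pep_instances by (simp add: mandelbrot_instance_def)
    show "compact (complex_pair ` cball z r)" by (simp add: complex_pair_image_cball)
    show "(real_quad c ^^ n) ` complex_pair ` cball z r \<subseteq> interior (complex_pair ` cball z r)"
      unfolding conj using image_mono[OF r(2), of complex_pair] ball by (rule subset_trans)
    show "(real_quad c ^^ i) ` complex_pair ` cball z r \<subseteq> interior {z. infnorm z \<le> 3}" for i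
      unfolding conj using r(4) by (auto intro!: norm_le_2_imp_interior)
    show "(real_quad c ^^ i) 0 \<in> interior {z. infnorm z \<le> 3}" for i
      using mandelbrot_orbit_norm_le[OF c] by (intro norm_le_2_imp_interior) (simp add: real_quad_funpow_zero)
    show "(real_quad c ^^ j) 0 \<in> interior (complex_pair ` cball z r)"
      using r(3) ball unfolding real_quad_funpow_zero by blast
  qed fact
  then show ?thesis by (simp add: mandelbrot_instance_def)
qed

text \<open>A perturbation \<open>g\<close> of \<open>quad c\<close> is conjugated by
  \<open>complex_pair\<close> to a perturbation \<open>G\<close> of \<open>real_quad c\<close>;
  since the conjugacy is isometric, \<open>\<epsilon>\<close> is unchanged.\<close>

lemma robust_mandelbrot_imp_uniformly_trapped:
  assumes "robust (mandelbrot_instance c)" "c \<in> mandelbrot"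
  obtains \<epsilon> where "0 < \<epsilon>"
    "\<And>g k. continuous_on UNIV g \<Longrightarrow> (\<And>z. dist (g z) (quad c z) < \<epsilon>) \<Longrightarrow>
      infnorm (complex_pair ((g ^^ k) 0)) \<le> 3"
proof -
  have "(real_quad c, {z. infnorm z \<le> 3}, 0) \<in> pep_instances"
    "robust (real_quad c, {z. infnorm z \<le> 3}, 0)" "trapped (real_quad c, {z. infnorm z \<le> 3}, 0)"
    using assms mandelbrot_instance_in_pep_instances mandelbrot_iff_trapped
    unfolding mandelbrot_instance_def by blast+
  then obtain \<epsilon> where \<epsilon>: "0 < \<epsilon>" "\<And>G. continuous_on UNIV G \<Longrightarrow>
      (\<And>p. dist (G p) (real_quad c p) < \<epsilon>) \<Longrightarrow> trapped (G, {z. infnorm z \<le> 3}, 0)"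
    using robust_trapped_uniform by blast
  have "infnorm (complex_pair ((g ^^ k) 0)) \<le> 3"
    if g: "continuous_on UNIV g" "\<And>z. dist (g z) (quad c z) < \<epsilon>" for g k
  proof -
    define G where "G = (\<lambda>p. complex_pair (g (Complex (fst p) (snd p))))"
    have G: "G (complex_pair z) = complex_pair (g z)" for z
      by (simp add: G_def complex_pair_def)
    have "continuous_on UNIV G"
      unfolding G_def complex_pair_def Complex_eq
      by (intro continuous_intros continuous_on_compose2[OF g(1)]) auto
    moreover have "dist (G p) (real_quad c p) < \<epsilon>" for p
    proof -
      obtain z where "p = complex_pair z" using range_complex_pair by blast
      then show ?thesis using g(2) by (simp add: G real_quad_complex_pair)
    qed
    ultimately have "trapped (G, {z. infnorm z \<le> 3}, 0)" by (rule \<epsilon>(2))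
    then have "infnorm ((G ^^ k) 0) \<le> 3" by (simp add: trapped_def escapes_def)
    then show ?thesis
      using funpow_complex_pair_conj[of G g k 0, OF G] by (simp add: complex_pair_def zero_prod_def)
  qed
  with \<epsilon>(1) show ?thesis using that by blast
qed

text \<open>The perturbations \<open>quad d\<close> show that \<open>c\<close> is interior to
  \<open>mandelbrot\<close>; arbitrary continuous perturbations give the bounded pseudo-orbits
  behind the attracting cycle.\<close>

lemma robust_mandelbrot_imp_hyperbolic_parameter:
  assumes "robust (mandelbrot_instance c)" "c \<in> mandelbrot"
  shows "hyperbolic_parameter c"
proof -
  obtain \<epsilon> where \<epsilon>: "0 < \<epsilon>"
    "\<And>g k. continuous_on UNIV g \<Longrightarrow> (\<And>z. dist (g z) (quad c z) < \<epsilon>) \<Longrightarrow>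
      infnorm (complex_pair ((g ^^ k) 0)) \<le> 3"
    using robust_mandelbrot_imp_uniformly_trapped[OF assms] by blast
  have "ball c \<epsilon> \<subseteq> mandelbrot"
  proof
    fix d assume "d \<in> ball c \<epsilon>"
    then have "infnorm (complex_pair ((quad d ^^ k) 0)) \<le> 3" for k
      by (intro \<epsilon>(2) continuous_on_quad) (simp add: quad_def dist_norm norm_minus_commute)
    then have "trapped (mandelbrot_instance d)"
      by (simp add: trapped_def escapes_def mandelbrot_instance_def real_quad_funpow_zero)
    then show "d \<in> mandelbrot" by (simp add: mandelbrot_iff_trapped)
  qed
  then have "c \<in> interior mandelbrot"
    using \<epsilon>(1) by (intro interiorI[of "ball c \<epsilon>"]) auto
  moreover have "has_attracting_cycle (quad c)"
  proof -
    have hol: "quad c holomorphic_on UNIV"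
      using holomorphic_on_quad_iterate[of 1] by simp
    have "(g ^^ k) 0 \<in> {z. infnorm (complex_pair z) \<le> 3}"
      if "continuous_on UNIV g" "\<And>z. dist (g z) (quad c z) < \<epsilon>" for g k
      using \<epsilon>(2)[OF that] by simp
    then obtain n p where "n \<ge> 1" "(quad c ^^ n) p = p" "norm (deriv (quad c ^^ n) p) < 1"
      using bounded_pseudo_orbits_imp_attracting_cycle[OF hol \<epsilon>(1) bounded_infnorm_complex_pair] by metis
    then show ?thesis using has_attracting_cycleI[OF hol] by blast
  qed
  ultimately show ?thesis by (simp add: hyperbolic_parameter_def)
qed

lemma hyperbolic_parameter_iff_component:
  "hyperbolic_parameter c \<longleftrightarrow> (\<exists>H. hyperbolic_component H \<and> c \<in> H)"
proof
  assume c: "hyperbolic_parameter c"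
  define H where "H = connected_component_set (interior mandelbrot) c"
  have "c \<in> interior mandelbrot" using c by (simp add: hyperbolic_parameter_def)
  then have H: "H \<in> components (interior mandelbrot)" "c \<in> H"
    unfolding H_def by (auto simp: components_def)
  then have "open H" "connected H" "H \<subseteq> interior mandelbrot"
    using open_components in_components_connected in_components_subset by blast+
  then have "hyperbolic_parameter d" if "d \<in> H" for d
    using attracting_cycle_persists_on_component[of H c d] c H(2) that interior_subset
    unfolding hyperbolic_parameter_def by blast
  then show "\<exists>H. hyperbolic_component H \<and> c \<in> H"
    using H unfolding hyperbolic_component_def by blast
qed (auto simp: hyperbolic_component_def)

lemma robust_mandelbrot_iff:
  "robust (mandelbrot_instance c) \<longleftrightarrow> c \<notin> mandelbrot \<or> hyperbolic_parameter c"
proof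
  assume "c \<notin> mandelbrot \<or> hyperbolic_parameter c"
  then show "robust (mandelbrot_instance c)"
  proof
    assume "c \<notin> mandelbrot"
    then have "escapes (mandelbrot_instance c)" by (simp add: mandelbrot_iff_trapped trapped_def)
    then show ?thesis
      using escapes_imp_robust mandelbrot_instance_in_pep_instances[of c]
      unfolding mandelbrot_instance_def by blast
  next
    assume "hyperbolic_parameter c"
    then show ?thesis
      using attracting_cycle_imp_robust interior_subset unfolding hyperbolic_parameter_def by blast
  qed
qed (use robust_mandelbrot_imp_hyperbolic_parameter in blast)

theorem theorem5p1:
  "(\<forall>c. mandelbrot_instance c \<in> pep_instances \<and>
        (c \<in> mandelbrot \<longleftrightarrow> trapped (mandelbrot_instance c))) \<and>
   (\<forall>c. robust (mandelbrot_instance c) \<longleftrightarrow>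
        c \<in> - mandelbrot \<or> (\<exists>H. hyperbolic_component H \<and> c \<in> H)) \<and>
   ((\<forall>c. c \<notin> frontier mandelbrot \<longrightarrow> robust (mandelbrot_instance c)) \<longleftrightarrow>
        hyperbolicity_conjecture)"
proof (intro conjI allI)
  \<comment> \<open>Off the frontier a parameter lies outside \<open>mandelbrot\<close>, where
    robustness always holds, or in its interior, where robustness means hyperbolicity.\<close>
  show "(\<forall>c. c \<notin> frontier mandelbrot \<longrightarrow> robust (mandelbrot_instance c)) \<longleftrightarrow> hyperbolicity_conjecture"
    unfolding hyperbolicity_conjecture_def robust_mandelbrot_iff frontier_def
    using closure_subset[of mandelbrot] interior_subset[of mandelbrot] by blast
qed (simp_all add: mandelbrot_instance_in_pep_instances mandelbrot_iff_trapped
    robust_mandelbrot_iff hyperbolic_parameter_iff_component)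

end
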